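(* Let $\alpha\in(0,\tfrac12]$, $s=p^{1-\alpha}$, and $A=\sqrt{p^{\alpha-\frac12+\delta}/n}$ where $0<\delta<\tfrac12$ and $\alpha-\tfrac12+\delta>0$. Assume either $\mathbf X\in\mathrm{SubG}(\sigma^2)$ with $n/p^2\to\infty$, or $\mathbf X\in\mathcal O_n(p)$ with $n\ge p$. Then $$\lim_{p\to\infty}\frac{\log\mathrm{Risk}(s,A)}{p^{\frac12+\delta}}=-\frac18.$$
   Context: Setting: for each $p$ one observes $(\mathbf y,\mathbf X)$ with $\mathbf y=\mathbf X\boldsymbol\beta+\boldsymbol\varepsilon$, where $\boldsymbol\varepsilon\sim\mathcal N(0,I_n)$, $\mathbf X$ is an $n\times p$ real matrix independent of $\boldsymbol\varepsilon$, $\boldsymbol\beta\in\mathbb R^p$ is unknown, and $n=n(p)\to\infty$ as $p\to\infty$. Design classes: $\mathbf X\in\mathrm{SubG}(\sigma^2)$ means the rows of $\mathbf X$ are i.i.d. centered isotropic ($\mathbb E[xx^T]=I_p$) sub-Gaussian random vectors with sub-Gaussian parameter $\sigma^2$ (for every unit $u$ and $t\in\mathbb R$, $\log\mathbb E e^{t\langle u,x\rangle}\le\sigma^2t^2/2$), and $\mathbf X^T\mathbf X$ is almost surely positive definite; $\mathbf X\in\mathcal O_n(p)$ means $\mathbf X^T\mathbf X=nI_p$. For an integer $s$ and $A>0$, $\Xi(s,A)=\{\boldsymbol\beta\in\mathbb R^p:|\mathrm{supp}(\boldsymbol\beta)|=s,\ |\beta_i|\ge A\text{ for }i\in\mathrm{supp}(\boldsymbol\beta)\}$.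 A test $T$ is a measurable $[0,1]$-valued function of $(\mathbf y,\mathbf X)$; $\mathbb P_{\boldsymbol\beta},\mathbb E_{\boldsymbol\beta}$ denote the law/expectation of $(\mathbf y,\mathbf X)$ (including the randomness of $\mathbf X$) under parameter $\boldsymbol\beta$, and $\mathbb P_0,\mathbb E_0$ those under $\boldsymbol\beta=0$. $\mathrm{Risk}(T,s,A)=\mathbb E_0[T]+\sup_{\boldsymbol\beta\in\Xi(s,A)}\mathbb E_{\boldsymbol\beta}[1-T]$ and $\mathrm{Risk}(s,A)=\inf_T\mathrm{Risk}(T,s,A)$. The sparsity is $s=p^{1-\alpha}$ (rounded to an integer) with $\alpha$ fixed; all limits are as $p\to\infty$. *)

theory Defs
  imports "HOL-Probability.Probability"
begin

text \<open>Vectors in R^n are functions nat => real restricted to {..<n};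
  an n x p matrix X is a function with X i j the (i,j) entry (row i < n, column j < p).\<close>

definition vec_space :: "nat \<Rightarrow> (nat \<Rightarrow> real) measure" where
  "vec_space n = PiM {..<n} (\<lambda>_. lborel)"

definition mat_space :: "nat \<Rightarrow> nat \<Rightarrow> (nat \<Rightarrow> nat \<Rightarrow> real) measure" where
  "mat_space n p = PiM {..<n} (\<lambda>_. vec_space p)"

definition noise :: "nat \<Rightarrow> (nat \<Rightarrow> real) measure" where
  "noise n = PiM {..<n} (\<lambda>_. density lborel std_normal_density)"

definition obs_law :: "nat \<Rightarrow> nat \<Rightarrow> (nat \<Rightarrow> nat \<Rightarrow> real) measure \<Rightarrow> (nat \<Rightarrow> real)
    \<Rightarrow> ((nat \<Rightarrow> real) \<times> (nat \<Rightarrow> nat \<Rightarrow> real)) measure" where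
  "obs_law n p D \<beta> =
     distr (D \<Otimes>\<^sub>M noise n) (vec_space n \<Otimes>\<^sub>M mat_space n p)
       (\<lambda>(X, e). ((\<lambda>i\<in>{..<n}. (\<Sum>j<p. X i j * \<beta> j) + e i), X))"

definition Xi :: "nat \<Rightarrow> nat \<Rightarrow> real \<Rightarrow> (nat \<Rightarrow> real) set" where
  "Xi p s A = {\<beta>. (\<forall>i. p \<le> i \<longrightarrow> \<beta> i = 0) \<and> card {i\<in>{..<p}. \<beta> i \<noteq> 0} = s
                 \<and> (\<forall>i<p. \<beta> i \<noteq> 0 \<longrightarrow> \<bar>\<beta> i\<bar> \<ge> A)}"

definition tests :: "nat \<Rightarrow> nat \<Rightarrow> ((nat \<Rightarrow> real) \<times> (nat \<Rightarrow> nat \<Rightarrow> real) \<Rightarrow> real) set" where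
  "tests n p = {T. T \<in> borel_measurable (vec_space n \<Otimes>\<^sub>M mat_space n p)
                   \<and> (\<forall>\<omega>. 0 \<le> T \<omega> \<and> T \<omega> \<le> 1)}"

definition risk_test :: "nat \<Rightarrow> nat \<Rightarrow> (nat \<Rightarrow> nat \<Rightarrow> real) measure \<Rightarrow> nat \<Rightarrow> real
    \<Rightarrow> ((nat \<Rightarrow> real) \<times> (nat \<Rightarrow> nat \<Rightarrow> real) \<Rightarrow> real) \<Rightarrow> real" where
  "risk_test n p D s A T =
     (\<integral>\<omega>. T \<omega> \<partial>obs_law n p D (\<lambda>_. 0))
     + (SUP \<beta>\<in>Xi p s A. \<integral>\<omega>. 1 - T \<omega> \<partial>obs_law n p D \<beta>)"

definition minimax_risk :: "nat \<Rightarrow> nat \<Rightarrow> (nat \<Rightarrow> nat \<Rightarrow> real) measure \<Rightarrow> nat \<Rightarrow> real \<Rightarrow> real" where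
  "minimax_risk n p D s A = (INF T\<in>tests n p. risk_test n p D s A T)"

definition subG_row :: "nat \<Rightarrow> real \<Rightarrow> (nat \<Rightarrow> real) measure \<Rightarrow> bool" where
  "subG_row p \<sigma>2 \<mu> \<longleftrightarrow> prob_space \<mu> \<and> sets \<mu> = sets (vec_space p)
     \<and> (\<forall>j<p. integrable \<mu> (\<lambda>x. x j) \<and> (\<integral>x. x j \<partial>\<mu>) = 0)
     \<and> (\<forall>j<p. \<forall>k<p. integrable \<mu> (\<lambda>x. x j * x k)
            \<and> (\<integral>x. x j * x k \<partial>\<mu>) = (if j = k then 1 else 0))
     \<and> (\<forall>u. (\<Sum>j<p. (u j)\<^sup>2) = 1 \<longrightarrow> (\<forall>t::real.
          (\<integral>\<^sup>+x. ennreal (exp (t * (\<Sum>j<p. u j * x j))) \<partial>\<mu>) \<le> ennreal (exp (\<sigma>2 * t\<^sup>2 / 2))))"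

definition gram_pos_def :: "nat \<Rightarrow> nat \<Rightarrow> (nat \<Rightarrow> nat \<Rightarrow> real) \<Rightarrow> bool" where
  "gram_pos_def n p X \<longleftrightarrow> (\<forall>v::nat \<Rightarrow> real. (\<exists>j<p. v j \<noteq> 0) \<longrightarrow>
      (\<Sum>j<p. \<Sum>k<p. v j * (\<Sum>i<n. X i j * X i k) * v k) > 0)"

definition subG_design :: "nat \<Rightarrow> nat \<Rightarrow> real \<Rightarrow> (nat \<Rightarrow> nat \<Rightarrow> real) measure \<Rightarrow> bool" where
  "subG_design n p \<sigma>2 D \<longleftrightarrow> (\<exists>\<mu>. subG_row p \<sigma>2 \<mu> \<and> D = PiM {..<n} (\<lambda>_. \<mu>))
     \<and> (AE X in D. gram_pos_def n p X)"

definition orth_design :: "nat \<Rightarrow> nat \<Rightarrow> (nat \<Rightarrow> nat \<Rightarrow> real) measure \<Rightarrow> bool" where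
  "orth_design n p D \<longleftrightarrow> prob_space D \<and> sets D = sets (mat_space n p)
     \<and> (AE X in D. \<forall>j<p. \<forall>k<p. (\<Sum>i<n. X i j * X i k) = (if j = k then real n else 0))"

end

theory Submission
  imports Defs "HOL-Real_Asymp.Real_Asymp"
begin

text \<open>
  Write \<open>M = n s A\<^sup>2\<close>, which is asymptotic to \<open>p powr (1/2 + \<delta>)\<close>.

  Lower bound: testing \<open>0\<close> against a single flat signal \<open>\<beta>\<close> already costs
  \<open>exp (- |X \<beta>|\<^sup>2/8)\<close> up to a factor \<open>exp (- O(|X \<beta>|))\<close>; Jensen's inequality replaces
  \<open>|X \<beta>|\<^sup>2\<close> by its mean \<open>M\<close>.

  Upper bound: reject if \<open>\<langle>X v, y\<rangle> > \<theta> |X v|\<close> for some signed indicator vector \<open>v\<close> of a support of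
  size \<open>s\<close>, with \<open>\<theta>\<close> slightly below \<open>sqrt M / 2\<close>. The union bound over the at most \<open>(2p)^s\<close> vectors
  is free because \<open>s ln p = o(M)\<close>, which is what \<open>\<alpha> - 1/2 + \<delta> > 0\<close> gives. Since \<open>\<beta>\<close> is fixed when the
  type II error is computed, no uniform control of \<open>X\<^sup>T X\<close> is needed: it suffices that
  \<open>\<langle>X v, X \<beta>\<rangle>\<close> and \<open>|X v|\<^sup>2\<close> concentrate for the sign pattern \<open>v\<close> of this \<open>\<beta>\<close>. The correlation of \<open>v\<close>
  and \<open>\<beta>\<close> is at least \<open>1 / sqrt s\<close>, so for sub-Gaussian rows this fails with probability
  \<open>exp (- c n / s)\<close>, and \<open>n / s\<close> dominates \<open>M\<close> as soon as \<open>n \<ge> c p\<^sup>2\<close>.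
\<close>

section \<open>Gaussian noise\<close>

definition mat_vec :: "nat \<Rightarrow> (nat \<Rightarrow> nat \<Rightarrow> real) \<Rightarrow> (nat \<Rightarrow> real) \<Rightarrow> nat \<Rightarrow> real" where
  "mat_vec p X b i = (\<Sum>j<p. X i j * b j)"

definition dot :: "nat \<Rightarrow> (nat \<Rightarrow> real) \<Rightarrow> (nat \<Rightarrow> real) \<Rightarrow> real" where
  "dot n u w = (\<Sum>i<n. u i * w i)"

lemma dot_self_nonneg: "0 \<le> dot n u u"
  by (auto simp: dot_def intro!: sum_nonneg)

lemma dot_commute: "dot n u v = dot n v u"
  by (simp add: dot_def mult.commute)

lemma dot_add_right: "dot n u (\<lambda>i. v i + w i) = dot n u v + dot n u w"
  by (simp add: dot_def sum.distrib algebra_simps)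

lemma dot_scale_left: "dot n (\<lambda>i. c * u i) v = c * dot n u v"
  by (simp add: dot_def sum_distrib_left algebra_simps)

lemma dot_scale_right: "dot n u (\<lambda>i. c * v i) = c * dot n u v"
  by (simp add: dot_def sum_distrib_left algebra_simps)

lemma dot_restrict_right: "dot n u (restrict v {..<n}) = dot n u v"
  by (simp add: dot_def)

lemma prob_space_std_normal: "prob_space (density lborel std_normal_density)"
  using prob_space_normal_density[of 1 0] by simp

lemma product_prob_space_std_normal: "product_prob_space (\<lambda>_::nat. density lborel std_normal_density)"
  by (intro product_prob_space.intro product_prob_space_axioms.intro product_sigma_finite.intro
      prob_space_imp_sigma_finite prob_space_std_normal)

lemma prob_space_noise: "prob_space (noise n)"
  unfolding noise_def by (intro prob_space_PiM prob_space_std_normal)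

lemma sets_noise[measurable_cong]: "sets (noise n) = sets (vec_space n)"
  unfolding noise_def vec_space_def by (intro sets_PiM_cong) auto

lemma measurable_vec_component[measurable]:
  "i < n \<Longrightarrow> (\<lambda>x. x i) \<in> borel_measurable (vec_space n)"
  unfolding vec_space_def by measurable

lemma measurable_row[measurable]:
  "i < n \<Longrightarrow> (\<lambda>X. X i) \<in> measurable (mat_space n p) (vec_space p)"
  unfolding mat_space_def by measurable

lemma measurable_into_vec_space[measurable]:
  assumes "\<And>i. i < n \<Longrightarrow> (\<lambda>x. f x i) \<in> borel_measurable M"
  shows "(\<lambda>x. \<lambda>i\<in>{..<n}. f x i) \<in> measurable M (vec_space n)"
  unfolding vec_space_def using assms by (intro measurable_restrict) auto

lemma measurable_dot[measurable]:
  assumes "\<And>i. i < n \<Longrightarrow> (\<lambda>x. f x i) \<in> borel_measurable M"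
    "\<And>i. i < n \<Longrightarrow> (\<lambda>x. g x i) \<in> borel_measurable M"
  shows "(\<lambda>x. dot n (f x) (g x)) \<in> borel_measurable M"
  unfolding dot_def using assms by (intro borel_measurable_sum borel_measurable_times) auto

lemma measurable_dot_noise[measurable]: "dot n a \<in> borel_measurable (noise n)"
proof -
  have "(\<lambda>e. dot n a e) \<in> borel_measurable (noise n)"
    by (intro measurable_dot) (auto simp: measurable_cong_sets[OF sets_noise refl])
  then show ?thesis by simp
qed

lemma measurable_shift_noise[measurable]:
  "(\<lambda>z. \<lambda>i\<in>{..<n}. a i + z i) \<in> measurable (noise n) (vec_space n)"
proof (rule measurable_into_vec_space)
  fix i assume "i < n"
  then have [measurable]: "(\<lambda>z. z i) \<in> borel_measurable (noise n)"
    by (simp add: measurable_cong_sets[OF sets_noise refl] measurable_vec_component)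
  show "(\<lambda>z. a i + z i) \<in> borel_measurable (noise n)" by measurable
qed

lemma measurable_mat_vec[measurable]:
  "i < n \<Longrightarrow> (\<lambda>X. mat_vec p X b i) \<in> borel_measurable (mat_space n p)"
proof -
  assume i: "i < n"
  have "(\<lambda>X. X i j) \<in> borel_measurable (mat_space n p)" if "j < p" for j
    using measurable_comp[OF measurable_row[OF i, of p] measurable_vec_component[OF that]]
    by (simp add: o_def)
  then show ?thesis
    unfolding mat_vec_def by (intro borel_measurable_sum borel_measurable_times) auto
qed

text \<open>Completing the square: \<open>exp (a * x - a\<^sup>2 / 2)\<close> times the standard
  density at \<open>x\<close> is the standard density at \<open>x - a\<close>. Testing on sets is
  enough because product measures are later compared on boxes only.\<close>

lemma emeasure_std_normal_shift:
  assumes [measurable]: "A \<in> sets borel"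
  shows "(\<integral>\<^sup>+x. ennreal (exp (a * x - a\<^sup>2 / 2)) * indicator A x \<partial>density lborel std_normal_density)
      = emeasure (density lborel std_normal_density) ((\<lambda>x. a + x) -` A)"
proof -
  have [measurable]: "(\<lambda>x. a + x) -` A \<in> sets borel"
    using measurable_sets[of "\<lambda>x::real. a + x" borel borel A] by simp
  have "(\<integral>\<^sup>+x. ennreal (exp (a * x - a\<^sup>2 / 2)) * indicator A x \<partial>density lborel std_normal_density)
      = (\<integral>\<^sup>+x. ennreal (std_normal_density x) * (ennreal (exp (a * x - a\<^sup>2 / 2)) * indicator A x) \<partial>lborel)"
    by (subst nn_integral_density) auto
  also have "\<dots> = (\<integral>\<^sup>+x. ennreal (std_normal_density (x - a)) * indicator A x \<partial>lborel)"
    by (intro nn_integral_cong)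
      (auto simp: std_normal_density_def ennreal_mult'[symmetric] mult_exp_exp power2_diff field_simps
        split: split_indicator)
  also have "\<dots> = (\<integral>\<^sup>+x. ennreal (std_normal_density x) * indicator A (a + x) \<partial>lborel)"
    by (subst nn_integral_real_affine[where c=1 and t=a]) auto
  also have "\<dots> = (\<integral>\<^sup>+x. ennreal (std_normal_density x) * indicator ((\<lambda>x. a + x) -` A) x \<partial>lborel)"
    by (intro nn_integral_cong) (auto split: split_indicator)
  also have "\<dots> = emeasure (density lborel std_normal_density) ((\<lambda>x. a + x) -` A)"
    by (subst emeasure_density) auto
  finally show ?thesis .
qed

text \<open>The Cameron-Martin formula in finite dimension. The likelihood factorises over
  coordinates, so the tilted law and the translated law are both the product of the shifted
  one-dimensional Gaussians; uniqueness of product measures reduces each identification to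
  boxes.\<close>

lemma noise_shift_measure:
  "density (noise n) (\<lambda>e. ennreal (exp (dot n a e - dot n a a / 2)))
    = distr (noise n) (vec_space n) (\<lambda>z. \<lambda>i\<in>{..<n}. a i + z i)"
proof -
  let ?N = "density lborel std_normal_density :: real measure"
  interpret N: product_prob_space "\<lambda>_::nat. ?N" by (rule product_prob_space_std_normal)
  let ?M = "\<lambda>i::nat. distr ?N lborel (\<lambda>x. a i + x)"
  have "prob_space (?M i)" for i
    by (intro prob_space.prob_space_distr prob_space_std_normal) auto
  then interpret M: product_sigma_finite ?M
    by (intro product_sigma_finite.intro prob_space_imp_sigma_finite) 
  have sets_eq: "sets (vec_space n) = sets (PiM {..<n} ?M)"
    unfolding vec_space_def by (intro sets_PiM_cong) auto
  have exp_prod: "ennreal (exp (dot n a e - dot n a a / 2))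
      = (\<Prod>i<n. ennreal (exp (a i * e i - (a i)\<^sup>2 / 2)))" for e
    by (subst prod_ennreal) (auto simp: exp_sum[symmetric] dot_def sum_subtractf sum_divide_distrib power2_eq_square)
  have shift: "emeasure (?M i) B = emeasure ?N ((\<lambda>x. a i + x) -` B)" if "B \<in> sets borel" for i B
    using that by (subst emeasure_distr) auto
  have "density (noise n) (\<lambda>e. ennreal (exp (dot n a e - dot n a a / 2))) = PiM {..<n} ?M"
  proof (rule M.PiM_eqI)
    fix B assume "\<And>i. i \<in> {..<n} \<Longrightarrow> B i \<in> sets (?M i)"
    then have B[measurable]: "B i \<in> sets borel" if "i < n" for i using that by auto
    have PB: "PiE {..<n} B \<in> sets (noise n)"
      unfolding noise_def using B by (intro sets_PiM_I_finite) auto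
    have "emeasure (density (noise n) (\<lambda>e. ennreal (exp (dot n a e - dot n a a / 2)))) (PiE {..<n} B)
        = (\<integral>\<^sup>+e. ennreal (exp (dot n a e - dot n a a / 2)) * indicator (PiE {..<n} B) e \<partial>noise n)"
      using PB by (subst emeasure_density) auto
    also have "\<dots> = (\<integral>\<^sup>+e. (\<Prod>i<n. ennreal (exp (a i * e i - (a i)\<^sup>2 / 2)) * indicator (B i) (e i)) \<partial>noise n)"
    proof (intro nn_integral_cong)
      fix e assume "e \<in> space (noise n)"
      \<comment> \<open>Membership in \<open>PiE\<close> also demands extensionality, so the
        indicator of the box is a product of coordinate indicators only on the space of
        \<open>noise n\<close>.\<close>
      then have "e \<in> extensional {..<n}" by (simp add: noise_def space_PiM PiE_def)
      then have "indicator (PiE {..<n} B) e = (\<Prod>i<n. indicator (B i) (e i) :: ennreal)"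
      proof (cases "e \<in> PiE {..<n} B")
        case True
        then have "\<forall>i\<in>{..<n}. e i \<in> B i" by (simp add: PiE_iff)
        then have "(\<Prod>i<n. indicator (B i) (e i) :: ennreal) = 1" by (intro prod.neutral) simp
        with True show ?thesis by simp
      next
        case False
        with \<open>e \<in> extensional {..<n}\<close> obtain i where "i < n" "e i \<notin> B i"
          by (metis PiE_iff lessThan_iff)
        then have "(\<Prod>i<n. indicator (B i) (e i) :: ennreal) = 0"
          by (intro prod_zero bexI[of _ i]) simp_all
        with False show ?thesis by simp
      qed
      then show "ennreal (exp (dot n a e - dot n a a / 2)) * indicator (PiE {..<n} B) e
          = (\<Prod>i<n. ennreal (exp (a i * e i - (a i)\<^sup>2 / 2)) * indicator (B i) (e i))"
        by (simp add: exp_prod prod.distrib)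
    qed
    also have "\<dots> = (\<Prod>i<n. \<integral>\<^sup>+x. ennreal (exp (a i * x - (a i)\<^sup>2 / 2)) * indicator (B i) x \<partial>?N)"
      unfolding noise_def using B by (intro N.product_nn_integral_prod) auto
    also have "\<dots> = (\<Prod>i<n. emeasure (?M i) (B i))"
      using B by (intro prod.cong) (auto simp: emeasure_std_normal_shift shift)
    finally show "emeasure (density (noise n) (\<lambda>e. ennreal (exp (dot n a e - dot n a a / 2)))) (PiE {..<n} B)
        = (\<Prod>i<n. emeasure (?M i) (B i))" .
  qed (auto simp: sets_noise sets_eq)
  moreover have "distr (noise n) (vec_space n) (\<lambda>z. \<lambda>i\<in>{..<n}. a i + z i) = PiM {..<n} ?M"
  proof (rule M.PiM_eqI)
    fix B assume "\<And>i. i \<in> {..<n} \<Longrightarrow> B i \<in> sets (?M i)"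
    then have B[measurable]: "B i \<in> sets borel" if "i < n" for i using that by auto
    have PB: "PiE {..<n} B \<in> sets (vec_space n)"
      unfolding vec_space_def using B by (intro sets_PiM_I_finite) auto
    have C: "(\<lambda>x. a i + x) -` B i \<in> sets borel" if "i < n" for i
      using measurable_sets[of "\<lambda>x::real. a i + x" borel borel "B i"] B[OF that] by simp
    have "emeasure (distr (noise n) (vec_space n) (\<lambda>z. \<lambda>i\<in>{..<n}. a i + z i)) (PiE {..<n} B)
        = emeasure (noise n) ((\<lambda>z. \<lambda>i\<in>{..<n}. a i + z i) -` PiE {..<n} B \<inter> space (noise n))"
      using PB by (subst emeasure_distr) auto
    also have "(\<lambda>z. \<lambda>i\<in>{..<n}. a i + z i) -` PiE {..<n} B \<inter> space (noise n)
        = PiE {..<n} (\<lambda>i. (\<lambda>x. a i + x) -` B i)"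
      by (auto simp: noise_def space_PiM PiE_def Pi_iff)
    also have "emeasure (noise n) \<dots> = (\<Prod>i<n. emeasure (?M i) (B i))"
      unfolding noise_def using B C by (subst N.emeasure_PiM) (auto intro!: prod.cong simp: shift)
    finally show "emeasure (distr (noise n) (vec_space n) (\<lambda>z. \<lambda>i\<in>{..<n}. a i + z i)) (PiE {..<n} B)
        = (\<Prod>i<n. emeasure (?M i) (B i))" .
  qed (auto simp: sets_eq)
  ultimately show ?thesis by simp
qed

lemma nn_integral_noise_shift:
  assumes [measurable]: "f \<in> borel_measurable (vec_space n)"
  shows "(\<integral>\<^sup>+z. f (\<lambda>i\<in>{..<n}. a i + z i) \<partial>noise n)
    = (\<integral>\<^sup>+e. ennreal (exp (dot n a e - dot n a a / 2)) * f e \<partial>noise n)"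
proof -
  have "(\<integral>\<^sup>+z. f (\<lambda>i\<in>{..<n}. a i + z i) \<partial>noise n)
      = (\<integral>\<^sup>+z. f z \<partial>distr (noise n) (vec_space n) (\<lambda>z. \<lambda>i\<in>{..<n}. a i + z i))"
    by (subst nn_integral_distr) auto
  also have "\<dots> = (\<integral>\<^sup>+e. ennreal (exp (dot n a e - dot n a a / 2)) * f e \<partial>noise n)"
    unfolding noise_shift_measure[symmetric]
    by (subst nn_integral_density) (auto simp: measurable_cong_sets[OF sets_noise refl])
  finally show ?thesis .
qed

text \<open>The tilted density is that of a translate and so has total mass one; the Gaussian moment
  generating function is read off from this normalisation.\<close>

lemma nn_integral_exp_dot_noise:
  "(\<integral>\<^sup>+e. ennreal (exp (dot n a e)) \<partial>noise n) = ennreal (exp (dot n a a / 2))"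
proof -
  interpret prob_space "noise n" by (rule prob_space_noise)
  have "(\<integral>\<^sup>+e. ennreal (exp (dot n a e)) \<partial>noise n)
      = (\<integral>\<^sup>+e. ennreal (exp (dot n a a / 2)) * (ennreal (exp (dot n a e - dot n a a / 2)) * 1) \<partial>noise n)"
    by (intro nn_integral_cong) (simp add: ennreal_mult'[symmetric] mult_exp_exp)
  also have "\<dots> = ennreal (exp (dot n a a / 2)) * (\<integral>\<^sup>+e. ennreal (exp (dot n a e - dot n a a / 2)) * 1 \<partial>noise n)"
    by (subst nn_integral_cmult) auto
  also have "\<dots> = ennreal (exp (dot n a a / 2))"
    by (subst nn_integral_noise_shift[symmetric]) (auto simp: emeasure_space_1)
  finally show ?thesis .
qed

text \<open>Chernoff's bound. For \<open>w = 0\<close> the event would be the whole space, which is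
  why \<open>w\<close> must be nonzero.\<close>

lemma noise_tail:
  assumes t: "0 \<le> t" and w: "0 < dot n w w"
  shows "emeasure (noise n) {e \<in> space (noise n). dot n w e \<ge> t * sqrt (dot n w w)} \<le> ennreal (exp (- t\<^sup>2 / 2))"
proof -
  define r where "r = sqrt (dot n w w)"
  have r: "0 < r" "r\<^sup>2 = dot n w w" using w by (auto simp: r_def)
  \<comment> \<open>This is the minimiser of \<open>l\<^sup>2 * r\<^sup>2 / 2 - l * t * r\<close>,
    with minimum \<open>- t\<^sup>2 / 2\<close>.\<close>
  define l where "l = t / r"
  have l: "0 \<le> l" "l * r = t" using t r by (auto simp: l_def)
  have l2: "l\<^sup>2 * dot n w w = t\<^sup>2" by (simp add: l(2)[symmetric] r(2)[symmetric] power_mult_distrib)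
  let ?S = "{e \<in> space (noise n). dot n w e \<ge> t * sqrt (dot n w w)}"
  have [measurable]: "?S \<in> sets (noise n)" by measurable
  have "emeasure (noise n) ?S = (\<integral>\<^sup>+e. indicator ?S e \<partial>noise n)" by simp
  also have "\<dots> \<le> (\<integral>\<^sup>+e. ennreal (exp (- t\<^sup>2)) * ennreal (exp (dot n (\<lambda>i. l * w i) e)) \<partial>noise n)"
  proof (intro nn_integral_mono)
    fix e
    have "exp (- t\<^sup>2) * exp (l * dot n w e) \<ge> 1" if "t * r \<le> dot n w e"
    proof -
      have "l * (t * r) \<le> l * dot n w e" using that l(1) by (rule mult_left_mono)
      moreover have "l * (t * r) = t\<^sup>2"
        by (metis l(2) mult.assoc mult.commute power2_eq_square)
      ultimately show ?thesis by (simp add: mult_exp_exp)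
    qed
    then show "indicator ?S e \<le> ennreal (exp (- t\<^sup>2)) * ennreal (exp (dot n (\<lambda>i. l * w i) e))"
      by (auto simp: ennreal_mult'[symmetric] dot_scale_left r_def split: split_indicator)
  qed
  also have "\<dots> = ennreal (exp (- t\<^sup>2)) * ennreal (exp (t\<^sup>2 / 2))"
    using l2 by (subst nn_integral_cmult, measurable, unfold nn_integral_exp_dot_noise)
      (simp add: dot_scale_left dot_scale_right power2_eq_square mult.assoc)
  also have "\<dots> = ennreal (exp (- t\<^sup>2 / 2))"
    by (simp add: ennreal_mult'[symmetric] mult_exp_exp field_simps)
  finally show ?thesis .
qed

lemma dot_eq_zero:
  assumes "dot n w w = 0"
  shows "dot n w e = 0"
proof -
  have "\<forall>i\<in>{..<n}. w i * w i = 0"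
    using assms unfolding dot_def by (subst (asm) sum_nonneg_eq_0_iff) auto
  then show ?thesis by (auto simp: dot_def)
qed

text \<open>Only some positive constant is wanted, valid for every \<open>w\<close>. At two standard
  deviations each tail has mass at most \<open>exp (-2)\<close>, hence at most a quarter.\<close>

lemma noise_two_sided:
  "ennreal (1/2) \<le> emeasure (noise n) {e \<in> space (noise n). \<bar>dot n w e\<bar> \<le> 2 * sqrt (dot n w w)}"
proof -
  interpret N: prob_space "noise n" by (rule prob_space_noise)
  have dot_m: "(\<lambda>e. dot n a e) \<in> borel_measurable (noise n)" for a by simp
  have meas: "{e \<in> space (noise n). \<bar>dot n w e\<bar> \<le> 2 * sqrt (dot n w w)} \<in> sets (noise n)"
    using dot_m[of w] by measurable
  show ?thesis
  proof (cases "dot n w w = 0")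
    case True
    have "ennreal (1/2) \<le> ennreal 1" by (intro ennreal_leI) simp
    also have "\<dots> = emeasure (noise n) {e \<in> space (noise n). \<bar>dot n w e\<bar> \<le> 2 * sqrt (dot n w w)}"
      using True by (simp add: dot_eq_zero N.emeasure_space_1)
    finally show ?thesis .
  next
    case False
    then have pos: "0 < dot n w w" using dot_self_nonneg[of n w] by linarith
    define B where "B a = {e \<in> space (noise n). dot n a e \<ge> 2 * sqrt (dot n a a)}" for a
    have B_sets: "B a \<in> sets (noise n)" for a
      unfolding B_def using dot_m[of a] by measurable
    have neg: "dot n (\<lambda>i. - w i) e = - dot n w e" for e
      using dot_scale_left[of n "-1" w e] by simp
    have neg2: "dot n (\<lambda>i. - w i) (\<lambda>i. - w i) = dot n w w" by (simp add: dot_def)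
    have B_neg: "B (\<lambda>i. - w i) = {e \<in> space (noise n). - dot n w e \<ge> 2 * sqrt (dot n w w)}"
      unfolding B_def neg2 unfolding neg ..
    have "exp (2::real) = exp 1 * exp 1" by (simp add: mult_exp_exp)
    also have "\<dots> \<ge> 2 * 2" using exp_ge_add_one_self[of 1] by (intro mult_mono) auto
    finally have "exp (-2::real) \<le> 1/4" by (simp add: exp_minus field_simps)
    have small: "emeasure (noise n) (B a) \<le> ennreal (1/4)" if "0 < dot n a a" for a
    proof -
      have "emeasure (noise n) (B a) \<le> ennreal (exp (- 2\<^sup>2 / 2))"
        unfolding B_def by (rule noise_tail[OF _ that]) simp
      also have "\<dots> \<le> ennreal (1/4)" using \<open>exp (-2::real) \<le> 1/4\<close> by (intro ennreal_leI) simp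
      finally show ?thesis .
    qed
    have small': "N.prob (B a) \<le> 1/4" if "0 < dot n a a" for a
      using small[OF that] by (simp add: N.emeasure_eq_measure)
    have "1 = N.prob (space (noise n))" by (simp add: N.prob_space)
    also have "\<dots> \<le> N.prob ({e \<in> space (noise n). \<bar>dot n w e\<bar> \<le> 2 * sqrt (dot n w w)}
        \<union> (B w \<union> B (\<lambda>i. - w i)))"
      using B_sets meas by (intro N.finite_measure_mono) (auto simp: B_neg, auto simp: B_def)
    also have "\<dots> \<le> N.prob {e \<in> space (noise n). \<bar>dot n w e\<bar> \<le> 2 * sqrt (dot n w w)}
        + (N.prob (B w) + N.prob (B (\<lambda>i. - w i)))"
      using B_sets meas
      by (intro order_trans[OF measure_Un_le] add_left_mono sets.Un measure_Un_le) auto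
    also have "\<dots> \<le> N.prob {e \<in> space (noise n). \<bar>dot n w e\<bar> \<le> 2 * sqrt (dot n w w)} + (1/4 + 1/4)"
      using pos by (intro add_mono small') (auto simp: neg2)
    finally have "1/2 \<le> N.prob {e \<in> space (noise n). \<bar>dot n w e\<bar> \<le> 2 * sqrt (dot n w w)}" by simp
    then show ?thesis unfolding N.emeasure_eq_measure by (rule ennreal_leI)
  qed
qed

text \<open>The density ratio of the two hypotheses is written relative to the midpoint law:
  \<open>min 1 L\<^sub>w = L\<^sub>w\<^sub>/\<^sub>2 exp (- |w|\<^sup>2/8 - |x|/2)\<close> with \<open>x = ln L\<^sub>w\<close>; this is what
  produces the sharp constant \<open>1/8\<close>.\<close>
lemma two_point_lower:
  assumes [measurable]: "f \<in> borel_measurable (vec_space n)"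
    and f01: "\<And>e. 0 \<le> f e \<and> f e \<le> (1::real)"
  shows "ennreal (1/2 * exp (- dot n w w / 8 - sqrt (dot n w w)))
    \<le> (\<integral>\<^sup>+e. ennreal (f e) \<partial>noise n) + (\<integral>\<^sup>+e. ennreal (1 - f (\<lambda>i\<in>{..<n}. w i + e i)) \<partial>noise n)"
proof -
  have [measurable]: "f \<in> borel_measurable (noise n)"
    by (simp add: measurable_cong_sets[OF sets_noise refl])
  have dot_m[measurable]: "(\<lambda>e. dot n a e) \<in> borel_measurable (vec_space n)" for a
    using measurable_dot_noise[of n a] by (simp add: measurable_cong_sets[OF sets_noise refl])
  have dot_m'[measurable]: "(\<lambda>e. dot n a e) \<in> borel_measurable (noise n)" for a by simp
  define q where "q = dot n w w"
  let ?h = "\<lambda>i. w i / 2"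
  have half: "dot n ?h e = dot n w e / 2" for e
    using dot_scale_left[of n "1/2" w e] by simp
  have hh: "dot n ?h ?h = q / 4"
    by (simp add: dot_def q_def sum_divide_distrib)
  define g where "g e = exp (- q / 8 - \<bar>dot n w e - q / 2\<bar> / 2)" for e
  have [measurable]: "g \<in> borel_measurable (vec_space n)" unfolding g_def by measurable
  have [measurable]: "g \<in> borel_measurable (noise n)" unfolding g_def by measurable
  \<comment> \<open>The chain climbs from the bound to the sum of the errors. On an event of mass at
    least one half, \<open>\<bar>dot n w z\<bar> / 2\<close> is at most \<open>sqrt q\<close>, which
    accounts for both correction factors.\<close>
  have "ennreal (1/2 * exp (- q / 8 - sqrt q)) = ennreal (exp (- q / 8 - sqrt q)) * ennreal (1/2)"
    by (subst ennreal_mult'[symmetric]) (simp, simp only: mult.commute)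
  also have "\<dots> \<le> ennreal (exp (- q / 8 - sqrt q))
      * emeasure (noise n) {e \<in> space (noise n). \<bar>dot n w e\<bar> \<le> 2 * sqrt q}"
    unfolding q_def by (intro mult_left_mono noise_two_sided) auto
  also have "\<dots> = (\<integral>\<^sup>+z. ennreal (exp (- q / 8 - sqrt q))
      * indicator {e \<in> space (noise n). \<bar>dot n w e\<bar> \<le> 2 * sqrt q} z \<partial>noise n)"
    using dot_m'[of w] by (intro nn_integral_cmult_indicator[symmetric]) measurable
  also have "\<dots> \<le> (\<integral>\<^sup>+z. ennreal (exp (- q / 8 - \<bar>dot n w z\<bar> / 2)) \<partial>noise n)"
    by (intro nn_integral_mono) (auto split: split_indicator)
  also have "\<dots> = (\<integral>\<^sup>+z. ennreal (g (\<lambda>i\<in>{..<n}. ?h i + z i)) \<partial>noise n)"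
  proof (intro nn_integral_cong)
    fix z
    \<comment> \<open>Around the midpoint \<open>w / 2\<close> the log likelihood ratio is centred:
      it equals \<open>dot n w z\<close> exactly.\<close>
    have "dot n w ?h = q / 2" by (subst dot_commute) (simp add: half q_def)
    then have "dot n w (\<lambda>i\<in>{..<n}. ?h i + z i) - q / 2 = dot n w z"
      unfolding dot_restrict_right dot_add_right by simp
    then show "ennreal (exp (- q / 8 - \<bar>dot n w z\<bar> / 2)) = ennreal (g (\<lambda>i\<in>{..<n}. ?h i + z i))"
      by (simp add: g_def)
  qed
  also have "\<dots> = (\<integral>\<^sup>+e. ennreal (exp (dot n ?h e - dot n ?h ?h / 2)) * ennreal (g e) \<partial>noise n)"
    by (rule nn_integral_noise_shift) simp
  \<comment> \<open>The Neyman-Pearson inequality, pointwise: for a likelihood ratio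
    \<open>L\<close> and a test value \<open>f\<close> in [0,1], \<open>f + L * (1 - f)\<close> is a
    convex combination of 1 and \<open>L\<close>, hence at least \<open>min 1 L\<close>.\<close>
  also have "\<dots> \<le> (\<integral>\<^sup>+e. ennreal (f e) + ennreal (exp (dot n w e - q / 2)) * ennreal (1 - f e) \<partial>noise n)"
  proof (intro nn_integral_mono)
    fix e
    define x where "x = dot n w e - q / 2"
    have "exp (dot n ?h e - dot n ?h ?h / 2) * g e = exp (x / 2 - \<bar>x\<bar> / 2)"
      unfolding hh unfolding g_def half mult_exp_exp x_def by (simp add: field_simps)
    also have "\<dots> \<le> min 1 (exp x)" by (auto simp: min_def abs_if)
    also have "\<dots> = f e * min 1 (exp x) + (1 - f e) * min 1 (exp x)" by (simp add: algebra_simps)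
    also have "\<dots> \<le> f e * 1 + (1 - f e) * exp x"
      using f01[of e] by (intro add_mono mult_left_mono) auto
    finally have "exp (dot n ?h e - dot n ?h ?h / 2) * g e \<le> f e + exp x * (1 - f e)"
      by (simp add: mult.commute)
    then have "ennreal (exp (dot n ?h e - dot n ?h ?h / 2) * g e) \<le> ennreal (f e + exp x * (1 - f e))"
      by (rule ennreal_leI)
    also have "\<dots> = ennreal (f e) + ennreal (exp x) * ennreal (1 - f e)"
      using f01[of e] by (subst ennreal_plus) (auto simp: ennreal_mult)
    finally show "ennreal (exp (dot n ?h e - dot n ?h ?h / 2)) * ennreal (g e)
        \<le> ennreal (f e) + ennreal (exp (dot n w e - q / 2)) * ennreal (1 - f e)"
      unfolding x_def by (subst (asm) ennreal_mult) (simp_all add: g_def)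
  qed
  also have "\<dots> = (\<integral>\<^sup>+e. ennreal (f e) \<partial>noise n)
      + (\<integral>\<^sup>+e. ennreal (exp (dot n w e - q / 2)) * ennreal (1 - f e) \<partial>noise n)"
    by (rule nn_integral_add) auto
  also have "(\<integral>\<^sup>+e. ennreal (exp (dot n w e - q / 2)) * ennreal (1 - f e) \<partial>noise n)
      = (\<integral>\<^sup>+e. ennreal (1 - f (\<lambda>i\<in>{..<n}. w i + e i)) \<partial>noise n)"
    unfolding q_def by (rule nn_integral_noise_shift[symmetric]) simp
  finally show ?thesis unfolding q_def .
qed

section \<open>Risk bounds for a general design\<close>

locale design =
  fixes n p :: nat and D :: "(nat \<Rightarrow> nat \<Rightarrow> real) measure"
  assumes prob_space_D: "prob_space D" and sets_D: "sets D = sets (mat_space n p)"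
begin

sublocale D: prob_space D by (rule prob_space_D)
sublocale noise: prob_space "noise n" by (rule prob_space_noise)
sublocale pair: pair_prob_space D "noise n" ..

declare sets_D[measurable_cong]

abbreviation "fit X b \<equiv> mat_vec p X b"

abbreviation "obs \<equiv> vec_space n \<Otimes>\<^sub>M mat_space n p"

lemma space_D: "space D = space (mat_space n p)"
  using sets_D by (rule sets_eq_imp_space_eq)

lemma measurable_fit[measurable]: "i < n \<Longrightarrow> (\<lambda>X. fit X b i) \<in> borel_measurable D"
  by (simp add: measurable_cong_sets[OF sets_D refl] measurable_mat_vec)

lemma measurable_obs_map[measurable]:
  "(\<lambda>(X, e). ((\<lambda>i\<in>{..<n}. fit X b i + e i), X)) \<in> measurable (D \<Otimes>\<^sub>M noise n) obs"
proof -
  have "(\<lambda>x. fit (fst x) b i + snd x i) \<in> borel_measurable (D \<Otimes>\<^sub>M noise n)" if i: "i < n" for i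
  proof -
    have "(\<lambda>e. e i) \<in> borel_measurable (noise n)"
      using i by (simp add: measurable_cong_sets[OF sets_noise refl] measurable_vec_component)
    from measurable_compose[OF measurable_snd this] measurable_compose[OF measurable_fst measurable_fit[OF i]]
    show ?thesis by (intro borel_measurable_add) auto
  qed
  then have "(\<lambda>x. \<lambda>i\<in>{..<n}. fit (fst x) b i + snd x i) \<in> measurable (D \<Otimes>\<^sub>M noise n) (vec_space n)"
    by (rule measurable_into_vec_space)
  moreover have "fst \<in> measurable (D \<Otimes>\<^sub>M noise n) (mat_space n p)"
    using measurable_fst[of D "noise n"] by (simp add: measurable_cong_sets[OF refl sets_D])
  ultimately show ?thesis unfolding case_prod_beta by (intro measurable_Pair) auto
qed

lemma obs_law_eq:
  "obs_law n p D b = distr (D \<Otimes>\<^sub>M noise n) obs (\<lambda>(X, e). ((\<lambda>i\<in>{..<n}. fit X b i + e i), X))"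
  by (simp add: obs_law_def mat_vec_def)

lemma prob_space_obs_law: "prob_space (obs_law n p D b)"
  unfolding obs_law_eq by (rule pair.prob_space_distr) (rule measurable_obs_map)

lemma sets_obs_law: "sets (obs_law n p D b) = sets obs"
  by (simp add: obs_law_def)

lemma nn_integral_obs_law:
  assumes [measurable]: "f \<in> borel_measurable obs"
  shows "(\<integral>\<^sup>+\<omega>. f \<omega> \<partial>obs_law n p D b)
    = (\<integral>\<^sup>+X. \<integral>\<^sup>+e. f ((\<lambda>i\<in>{..<n}. fit X b i + e i), X) \<partial>noise n \<partial>D)"
proof -
  have "(\<integral>\<^sup>+\<omega>. f \<omega> \<partial>obs_law n p D b)
      = (\<integral>\<^sup>+x. f ((\<lambda>(X, e). ((\<lambda>i\<in>{..<n}. fit X b i + e i), X)) x) \<partial>(D \<Otimes>\<^sub>M noise n))"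
    unfolding obs_law_eq by (rule nn_integral_distr[OF measurable_obs_map]) simp
  also have "\<dots> = (\<integral>\<^sup>+X. \<integral>\<^sup>+e. f ((\<lambda>(X, e). ((\<lambda>i\<in>{..<n}. fit X b i + e i), X)) (X, e)) \<partial>noise n \<partial>D)"
    by (rule noise.nn_integral_fst[symmetric]) (rule measurable_compose[OF measurable_obs_map assms])
  finally show ?thesis by simp
qed

lemma nn_integral_obs_law_0:
  assumes [measurable]: "f \<in> borel_measurable obs"
  shows "(\<integral>\<^sup>+\<omega>. f \<omega> \<partial>obs_law n p D (\<lambda>_. 0)) = (\<integral>\<^sup>+X. \<integral>\<^sup>+e. f (e, X) \<partial>noise n \<partial>D)"
  unfolding nn_integral_obs_law[OF assms]
proof (intro nn_integral_cong)
  fix X e assume "e \<in> space (noise n)"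
  then have "restrict e {..<n} = e" by (simp add: noise_def space_PiM PiE_def extensional_restrict)
  then show "f (\<lambda>i\<in>{..<n}. fit X (\<lambda>_. 0) i + e i, X) = f (e, X)"
    by (simp add: mat_vec_def)
qed

lemma tests_measurable:
  assumes "T \<in> tests n p"
  shows "T \<in> borel_measurable obs" "\<And>\<omega>. 0 \<le> T \<omega>" "\<And>\<omega>. T \<omega> \<le> 1"
  using assms by (auto simp: tests_def)

lemma integrable_test:
  assumes "f \<in> borel_measurable obs" "\<And>\<omega>. 0 \<le> f \<omega> \<and> f \<omega> \<le> (1::real)"
  shows "integrable (obs_law n p D b) f"
proof -
  interpret prob_space "obs_law n p D b" by (rule prob_space_obs_law)
  show ?thesis
    using assms by (intro integrable_const_bound[where B=1]) (auto simp: measurable_cong_sets[OF sets_obs_law refl])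
qed

lemma ennreal_integral_test:
  assumes "f \<in> borel_measurable obs" "\<And>\<omega>. 0 \<le> f \<omega> \<and> f \<omega> \<le> (1::real)"
  shows "ennreal (\<integral>\<omega>. f \<omega> \<partial>obs_law n p D b) = (\<integral>\<^sup>+\<omega>. ennreal (f \<omega>) \<partial>obs_law n p D b)"
  using nn_integral_eq_integral[OF integrable_test[OF assms]] assms(2) by simp

lemma integral_test_le_1:
  assumes "f \<in> borel_measurable obs" "\<And>\<omega>. 0 \<le> f \<omega> \<and> f \<omega> \<le> (1::real)"
  shows "(\<integral>\<omega>. f \<omega> \<partial>obs_law n p D b) \<le> 1"
proof -
  interpret prob_space "obs_law n p D b" by (rule prob_space_obs_law)
  show ?thesis using assms(2) by (intro integral_le_const integrable_test assms) auto
qed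

text \<open>A real supremum dominates its members only when the family is bounded above; here all
  error probabilities are at most one.\<close>

lemma risk_test_ge:
  assumes T: "T \<in> tests n p" and b: "b \<in> Xi p s A"
  shows "(\<integral>\<omega>. T \<omega> \<partial>obs_law n p D (\<lambda>_. 0)) + (\<integral>\<omega>. 1 - T \<omega> \<partial>obs_law n p D b) \<le> risk_test n p D s A T"
proof -
  note tests_measurable(1)[OF T, measurable]
  have "bdd_above ((\<lambda>b. \<integral>\<omega>. 1 - T \<omega> \<partial>obs_law n p D b) ` Xi p s A)"
    using tests_measurable(2,3)[OF T] by (intro bdd_aboveI[of _ 1]) (auto intro!: integral_test_le_1)
  then show ?thesis unfolding risk_test_def using b by (auto intro!: cSUP_upper)
qed

text \<open>Supplies the lower bound that makes the infimum over tests meaningful. The class of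
  signals has to be nonempty because the real supremum over an empty set carries no
  information.\<close>

lemma risk_test_nonneg:
  assumes T: "T \<in> tests n p" and "Xi p s A \<noteq> {}"
  shows "0 \<le> risk_test n p D s A T"
proof -
  obtain b where b: "b \<in> Xi p s A" using assms by auto
  have "0 \<le> (\<integral>\<omega>. T \<omega> \<partial>obs_law n p D (\<lambda>_. 0)) + (\<integral>\<omega>. 1 - T \<omega> \<partial>obs_law n p D b)"
    using tests_measurable(2,3)[OF T] by (intro add_nonneg_nonneg integral_nonneg) auto
  then show ?thesis using risk_test_ge[OF T b] by simp
qed

lemma minimax_risk_le:
  assumes "T \<in> tests n p" "Xi p s A \<noteq> {}"
  shows "minimax_risk n p D s A \<le> risk_test n p D s A T"
  unfolding minimax_risk_def using assms
  by (intro cINF_lower bdd_belowI2[of _ 0] risk_test_nonneg) auto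

lemma measurable_fit_dot[measurable]:
  "(\<lambda>X. dot n (fit X a) (fit X b)) \<in> borel_measurable D"
  by (intro measurable_dot measurable_fit)

lemma section_measurable:
  assumes f: "f \<in> borel_measurable obs" and X: "X \<in> space D"
  shows "(\<lambda>e. f (e, X)) \<in> borel_measurable (vec_space n)"
  using X by (intro measurable_compose[OF measurable_Pair2' f]) (simp add: space_D)

text \<open>Conditionally on \<open>X\<close> the problem is Gaussian with means 0 and
  \<open>X b\<close>, so \<open>two_point_lower\<close> applies. Its square root is first absorbed
  into an affine function of \<open>|X b|^2\<close>; the exponential of an affine function is
  convex, and Jensen's inequality then needs nothing but the mean \<open>m\<close>.\<close>

lemma risk_test_lower:
  assumes T: "T \<in> tests n p" and b: "b \<in> Xi p s A" and \<eta>: "0 < \<eta>"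
    and int: "integrable D (\<lambda>X. dot n (fit X b) (fit X b))"
    and mean: "(\<integral>X. dot n (fit X b) (fit X b) \<partial>D) = m"
  shows "1/2 * exp (- (1 + \<eta>) * m / 8 - 2 / \<eta>) \<le> risk_test n p D s A T"
proof -
  note TM = tests_measurable(1)[OF T, measurable]
  note T01 = tests_measurable(2,3)[OF T]
  let ?q = "\<lambda>X. dot n (fit X b) (fit X b)"
  let ?a = "\<lambda>x. - (1 + \<eta>) * x / 8 - 2 / \<eta>"
  have sq: "sqrt x \<le> \<eta> * x / 8 + 2 / \<eta>" if "0 \<le> x" for x
  proof -
    \<comment> \<open>The arithmetic-geometric inequality, weighted so that the square root only
      changes the coefficient 1/8 to \<open>(1 + \<eta>) / 8\<close>, at the price of the constant
      \<open>2 / \<eta>\<close>.\<close>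
    have "0 \<le> (\<eta> * sqrt x / 4 - 1)\<^sup>2 * 2" by simp
    also have "\<dots> = \<eta> * (\<eta> * x / 8 + 2 / \<eta> - sqrt x)"
      using that \<eta> by (simp add: power2_diff power_mult_distrib power_divide algebra_simps) (simp add: power2_eq_square)
    finally show ?thesis using \<eta> by (simp add: zero_le_mult_iff)
  qed
  have int_a: "integrable D (\<lambda>X. ?a (?q X))" using int by auto
  have meas_a[measurable]: "(\<lambda>X. ?a (?q X)) \<in> borel_measurable D" by measurable
  have a_le: "?a (?q X) \<le> 0" for X
  proof -
    have "0 \<le> (1 + \<eta>) * ?q X / 8" "0 \<le> 2 / \<eta>"
      using \<eta> dot_self_nonneg[of n "fit X b"] by (auto intro!: mult_nonneg_nonneg)
    moreover have "- (1 + \<eta>) * ?q X / 8 = - ((1 + \<eta>) * ?q X / 8)"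
      by (simp add: algebra_simps)
    ultimately show ?thesis by linarith
  qed
  have int_e: "integrable D (\<lambda>X. 1/2 * exp (?a (?q X)))"
    using a_le by (intro integrable_mult_right D.integrable_const_bound[where B=1]) auto
  \<comment> \<open>Jensen by hand: the tangent line of \<open>exp\<close> at \<open>?a m\<close>
    lies below the curve, and its linear term integrates to zero.\<close>
  have lin: "exp (?a m) * (1 + (?a (?q X) - ?a m)) \<le> exp (?a (?q X))" for X
  proof -
    have "exp (?a m) * (1 + (?a (?q X) - ?a m)) \<le> exp (?a m) * exp (?a (?q X) - ?a m)"
      by (intro mult_left_mono exp_ge_add_one_self) auto
    then show ?thesis by (simp add: mult_exp_exp)
  qed
  have "exp (?a m) = (\<integral>X. exp (?a m) * (1 + (?a (?q X) - ?a m)) \<partial>D)"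
    using int mean by (simp add: D.prob_space)
  also have "\<dots> \<le> (\<integral>X. exp (?a (?q X)) \<partial>D)"
  proof (intro integral_mono lin)
    show "integrable D (\<lambda>X. exp (?a (?q X)))"
      using a_le by (intro D.integrable_const_bound[where B=1]) auto
  qed (use int in auto)
  finally have J: "1/2 * exp (?a m) \<le> (\<integral>X. 1/2 * exp (?a (?q X)) \<partial>D)" by simp
  have "ennreal (1/2 * exp (?a m)) \<le> ennreal (\<integral>X. 1/2 * exp (?a (?q X)) \<partial>D)"
    using J by (rule ennreal_leI)
  also have "\<dots> = (\<integral>\<^sup>+X. ennreal (1/2 * exp (?a (?q X))) \<partial>D)"
    by (rule nn_integral_eq_integral[symmetric, OF int_e]) simp
  also have "\<dots> \<le> (\<integral>\<^sup>+X. (\<integral>\<^sup>+e. ennreal (T (e, X)) \<partial>noise n)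
      + (\<integral>\<^sup>+e. ennreal (1 - T (\<lambda>i\<in>{..<n}. fit X b i + e i, X)) \<partial>noise n) \<partial>D)"
  proof (intro nn_integral_mono)
    fix X assume X: "X \<in> space D"
    have "1/2 * exp (?a (?q X)) \<le> 1/2 * exp (- ?q X / 8 - sqrt (?q X))"
    proof -
      have "?a (?q X) = - ?q X / 8 - (\<eta> * ?q X / 8 + 2 / \<eta>)" by (simp add: field_simps)
      then have "?a (?q X) \<le> - ?q X / 8 - sqrt (?q X)"
        using sq[OF dot_self_nonneg, of n "fit X b"] by linarith
      then show ?thesis by (intro mult_left_mono[OF iffD2[OF exp_le_cancel_iff]]) simp_all
    qed
    then have "ennreal (1/2 * exp (?a (?q X))) \<le> ennreal (1/2 * exp (- ?q X / 8 - sqrt (?q X)))"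
      by (rule ennreal_leI)
    also have "\<dots> \<le> (\<integral>\<^sup>+e. ennreal (T (e, X)) \<partial>noise n)
      + (\<integral>\<^sup>+e. ennreal (1 - T (\<lambda>i\<in>{..<n}. fit X b i + e i, X)) \<partial>noise n)"
      using T01 by (intro two_point_lower section_measurable TM X) auto
    finally show "ennreal (1/2 * exp (?a (?q X))) \<le> (\<integral>\<^sup>+e. ennreal (T (e, X)) \<partial>noise n)
      + (\<integral>\<^sup>+e. ennreal (1 - T (\<lambda>i\<in>{..<n}. fit X b i + e i, X)) \<partial>noise n)" .
  qed
  also have "\<dots> = (\<integral>\<^sup>+X. (\<integral>\<^sup>+e. ennreal (T (e, X)) \<partial>noise n) \<partial>D)
      + (\<integral>\<^sup>+X. (\<integral>\<^sup>+e. ennreal (1 - T (\<lambda>i\<in>{..<n}. fit X b i + e i, X)) \<partial>noise n) \<partial>D)"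
  proof (rule nn_integral_add)
    have "(\<lambda>x. ennreal (T (snd x, fst x))) \<in> borel_measurable (D \<Otimes>\<^sub>M noise n)"
      by measurable
    then show "(\<lambda>X. \<integral>\<^sup>+e. ennreal (T (e, X)) \<partial>noise n) \<in> borel_measurable D"
      by (intro noise.borel_measurable_nn_integral) (simp add: case_prod_beta)
    have "(\<lambda>x. ennreal (1 - T ((\<lambda>(X, e). ((\<lambda>i\<in>{..<n}. fit X b i + e i), X)) x))) \<in> borel_measurable (D \<Otimes>\<^sub>M noise n)"
      using measurable_compose[OF measurable_obs_map TM] by (intro measurable_compose[OF _ measurable_ennreal] borel_measurable_diff) auto
    then show "(\<lambda>X. \<integral>\<^sup>+e. ennreal (1 - T (\<lambda>i\<in>{..<n}. fit X b i + e i, X)) \<partial>noise n) \<in> borel_measurable D"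
      by (intro noise.borel_measurable_nn_integral) (simp add: case_prod_beta)
  qed
  also have "\<dots> = (\<integral>\<^sup>+\<omega>. ennreal (T \<omega>) \<partial>obs_law n p D (\<lambda>_. 0)) + (\<integral>\<^sup>+\<omega>. ennreal (1 - T \<omega>) \<partial>obs_law n p D b)"
    by (subst nn_integral_obs_law_0, simp, subst nn_integral_obs_law) auto
  also have "\<dots> = ennreal (\<integral>\<omega>. T \<omega> \<partial>obs_law n p D (\<lambda>_. 0)) + ennreal (\<integral>\<omega>. 1 - T \<omega> \<partial>obs_law n p D b)"
    using T01 by (subst (1 2) ennreal_integral_test) auto
  also have "\<dots> = ennreal ((\<integral>\<omega>. T \<omega> \<partial>obs_law n p D (\<lambda>_. 0)) + (\<integral>\<omega>. 1 - T \<omega> \<partial>obs_law n p D b))"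
    using T01 by (intro ennreal_plus[symmetric] integral_nonneg) auto
  also have "\<dots> \<le> ennreal (risk_test n p D s A T)"
    by (intro ennreal_leI risk_test_ge T b)
  finally show ?thesis
    using risk_test_nonneg[OF T, of s A] b by (subst (asm) ennreal_le_iff) auto
qed

lemma minimax_risk_lower:
  assumes b: "b \<in> Xi p s A" and \<eta>: "0 < \<eta>"
    and int: "integrable D (\<lambda>X. dot n (fit X b) (fit X b))"
    and mean: "(\<integral>X. dot n (fit X b) (fit X b) \<partial>D) = m"
  shows "1/2 * exp (- (1 + \<eta>) * m / 8 - 2 / \<eta>) \<le> minimax_risk n p D s A"
proof -
  \<comment> \<open>The infimum of reals is bounded below by a common lower bound only if the set is
    nonempty; the test that never rejects is a witness.\<close>
  have "(\<lambda>_. 0) \<in> tests n p" by (simp add: tests_def)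
  then show ?thesis unfolding minimax_risk_def
    using risk_test_lower[OF _ assms] by (intro cINF_greatest) auto
qed

end

section \<open>The scan test and its two errors\<close>

definition scan_test ::
  "nat \<Rightarrow> nat \<Rightarrow> (nat \<Rightarrow> real) set \<Rightarrow> real \<Rightarrow> (nat \<Rightarrow> real) \<times> (nat \<Rightarrow> nat \<Rightarrow> real) \<Rightarrow> real" where
  "scan_test n p V \<theta> = (\<lambda>(y, X).
     if \<exists>v\<in>V. \<theta> * sqrt (dot n (mat_vec p X v) (mat_vec p X v)) < dot n (mat_vec p X v) y then 1 else 0)"

context design
begin

lemma measurable_noise_dot_less:
  "{e \<in> space (noise n). c < dot n w e} \<in> sets (noise n)"
  "{e \<in> space (noise n). c \<le> dot n w e} \<in> sets (noise n)"
  using measurable_dot_noise[of n w] by measurable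

lemma scan_test_in_tests:
  assumes "finite V"
  shows "scan_test n p V \<theta> \<in> tests n p"
proof -
  have fits: "(\<lambda>\<omega>. mat_vec p (snd \<omega>) v i) \<in> borel_measurable obs" if "i < n" for v i
    by (rule measurable_compose[OF measurable_snd measurable_mat_vec[OF that]])
  have ys: "(\<lambda>\<omega>. fst \<omega> i) \<in> borel_measurable obs" if "i < n" for i
    by (rule measurable_compose[OF measurable_fst measurable_vec_component[OF that]])
  have [measurable]: "(\<lambda>\<omega>. dot n (mat_vec p (snd \<omega>) v) (mat_vec p (snd \<omega>) v)) \<in> borel_measurable obs"
    "(\<lambda>\<omega>. dot n (mat_vec p (snd \<omega>) v) (fst \<omega>)) \<in> borel_measurable obs" for v
    by (intro measurable_dot fits ys; assumption)+
  have [measurable]: "Measurable.pred obs (\<lambda>\<omega>. \<exists>v\<in>V. \<theta> * sqrt (dot n (mat_vec p (snd \<omega>) v) (mat_vec p (snd \<omega>) v))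
      < dot n (mat_vec p (snd \<omega>) v) (fst \<omega>))"
    using assms by (intro pred_intros_finite(4)) measurable
  have "scan_test n p V \<theta> \<in> borel_measurable obs"
    unfolding scan_test_def case_prod_beta by measurable
  then show ?thesis by (auto simp: tests_def scan_test_def)
qed

text \<open>For fixed \<open>X\<close> and \<open>v\<close> the normalised statistic is standard
  Gaussian under the null hypothesis. The union bound over \<open>V\<close> does not depend on
  \<open>X\<close>, so it survives averaging over the design.\<close>

lemma scan_test_type_I:
  assumes V: "finite V" and \<theta>: "0 < \<theta>"
  shows "(\<integral>\<omega>. scan_test n p V \<theta> \<omega> \<partial>obs_law n p D (\<lambda>_. 0)) \<le> card V * exp (- \<theta>\<^sup>2 / 2)"
proof -
  note T = scan_test_in_tests[OF V, of \<theta>]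
  note TM = tests_measurable(1)[OF T, measurable]
  have "ennreal (\<integral>\<omega>. scan_test n p V \<theta> \<omega> \<partial>obs_law n p D (\<lambda>_. 0))
      = (\<integral>\<^sup>+X. \<integral>\<^sup>+e. ennreal (scan_test n p V \<theta> (e, X)) \<partial>noise n \<partial>D)"
    using tests_measurable(2,3)[OF T] by (subst ennreal_integral_test) (auto intro!: nn_integral_obs_law_0)
  also have "\<dots> \<le> (\<integral>\<^sup>+X. ennreal (card V * exp (- \<theta>\<^sup>2 / 2)) \<partial>D)"
  proof (intro nn_integral_mono)
    fix X
    let ?E = "\<lambda>v. {e \<in> space (noise n). \<theta> * sqrt (dot n (fit X v) (fit X v)) < dot n (fit X v) e}"
    have E: "emeasure (noise n) (?E v) \<le> ennreal (exp (- \<theta>\<^sup>2 / 2))" for v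
    proof (cases "dot n (fit X v) (fit X v) = 0")
      \<comment> \<open>When \<open>X v = 0\<close> both sides of the rejection rule vanish, and its
        strict inequality never holds. This is why the rule multiplies by the norm instead of
        dividing by it.\<close>
      case True
      then show ?thesis by (simp add: dot_eq_zero)
    next
      case False
      then have pos: "0 < dot n (fit X v) (fit X v)" using dot_self_nonneg[of n "fit X v"] by linarith
      have "emeasure (noise n) (?E v)
          \<le> emeasure (noise n) {e \<in> space (noise n). dot n (fit X v) e \<ge> \<theta> * sqrt (dot n (fit X v) (fit X v))}"
        by (intro emeasure_mono measurable_noise_dot_less) auto
      also have "\<dots> \<le> ennreal (exp (- \<theta>\<^sup>2 / 2))" using \<theta> by (intro noise_tail pos) auto
      finally show ?thesis .
    qed
    have "(\<integral>\<^sup>+e. ennreal (scan_test n p V \<theta> (e, X)) \<partial>noise n) \<le> (\<integral>\<^sup>+e. indicator (\<Union>v\<in>V. ?E v) e \<partial>noise n)"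
      by (intro nn_integral_mono) (auto simp: scan_test_def split: split_indicator)
    also have "\<dots> = emeasure (noise n) (\<Union>v\<in>V. ?E v)"
      using V by (intro nn_integral_indicator sets.finite_UN measurable_noise_dot_less)
    also have "\<dots> \<le> (\<Sum>v\<in>V. emeasure (noise n) (?E v))"
      using V by (intro emeasure_subadditive_finite) (auto intro: measurable_noise_dot_less)
    also have "\<dots> \<le> (\<Sum>v\<in>V. ennreal (exp (- \<theta>\<^sup>2 / 2)))" by (intro sum_mono E)
    also have "\<dots> = ennreal (card V * exp (- \<theta>\<^sup>2 / 2))"
      by (simp add: ennreal_mult ennreal_of_nat_eq_real_of_nat)
    finally show "(\<integral>\<^sup>+e. ennreal (scan_test n p V \<theta> (e, X)) \<partial>noise n) \<le> ennreal (card V * exp (- \<theta>\<^sup>2 / 2))" .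
  qed
  also have "\<dots> = ennreal (card V * exp (- \<theta>\<^sup>2 / 2))" by (simp add: D.emeasure_space_1)
  finally show ?thesis by (subst (asm) ennreal_le_iff) auto
qed

text \<open>Acceptance means that in particular \<open>v\<close> did not trigger. On
  \<open>G\<close> the signal alone exceeds the threshold by \<open>\<kappa> * |X v|\<close>, so the
  noise has to compensate with a deviation of \<open>\<kappa>\<close> standard deviations; off
  \<open>G\<close> the error is bounded by one.\<close>

lemma scan_test_type_II:
  assumes V: "finite V" and v: "v \<in> V" and \<kappa>: "0 \<le> \<kappa>"
    and G: "G \<in> sets D" "D.prob (space D - G) \<le> \<epsilon>"
    and sep: "\<And>X. X \<in> G \<Longrightarrow> 0 < dot n (fit X v) (fit X v) \<and>
      (\<theta> + \<kappa>) * sqrt (dot n (fit X v) (fit X v)) \<le> dot n (fit X v) (fit X b)"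
  shows "(\<integral>\<omega>. 1 - scan_test n p V \<theta> \<omega> \<partial>obs_law n p D b) \<le> \<epsilon> + exp (- \<kappa>\<^sup>2 / 2)"
proof -
  note T = scan_test_in_tests[OF V, of \<theta>]
  note TM = tests_measurable(1)[OF T, measurable]
  have "0 \<le> \<epsilon>" using G(2) measure_nonneg order_trans by blast
  have "ennreal (\<integral>\<omega>. 1 - scan_test n p V \<theta> \<omega> \<partial>obs_law n p D b)
      = (\<integral>\<^sup>+\<omega>. ennreal (1 - scan_test n p V \<theta> \<omega>) \<partial>obs_law n p D b)"
    using tests_measurable(2,3)[OF T] by (intro ennreal_integral_test) auto
  also have "\<dots> = (\<integral>\<^sup>+X. \<integral>\<^sup>+e. ennreal (1 - scan_test n p V \<theta> (\<lambda>i\<in>{..<n}. fit X b i + e i, X)) \<partial>noise n \<partial>D)"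
    by (rule nn_integral_obs_law) measurable
  also have "\<dots> \<le> (\<integral>\<^sup>+X. indicator (space D - G) X + ennreal (exp (- \<kappa>\<^sup>2 / 2)) \<partial>D)"
  proof (intro nn_integral_mono)
    fix X assume X: "X \<in> space D"
    show "(\<integral>\<^sup>+e. ennreal (1 - scan_test n p V \<theta> (\<lambda>i\<in>{..<n}. fit X b i + e i, X)) \<partial>noise n)
        \<le> indicator (space D - G) X + ennreal (exp (- \<kappa>\<^sup>2 / 2))"
    proof (cases "X \<in> G")
      case False
      have "(\<integral>\<^sup>+e. ennreal (1 - scan_test n p V \<theta> (\<lambda>i\<in>{..<n}. fit X b i + e i, X)) \<partial>noise n)
          \<le> (\<integral>\<^sup>+e. 1 \<partial>noise n)"
        using tests_measurable(2)[OF T] by (intro nn_integral_mono) simp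
      also have "\<dots> = 1" by (simp add: noise.emeasure_space_1)
      finally show ?thesis using False X by (simp add: add_increasing2)
    next
      case True
      \<comment> \<open>The sign change turns the lower tail needed here into the upper tail of
        \<open>noise_tail\<close>.\<close>
      let ?w = "fit X v" and ?m = "\<lambda>i. - fit X v i"
      have neg: "dot n ?m e = - dot n ?w e" for e
        using dot_scale_left[of n "-1" ?w e] by simp
      have neg2: "dot n ?m ?m = dot n ?w ?w" by (simp add: dot_def)
      have "(\<integral>\<^sup>+e. ennreal (1 - scan_test n p V \<theta> (\<lambda>i\<in>{..<n}. fit X b i + e i, X)) \<partial>noise n)
          \<le> (\<integral>\<^sup>+e. indicator {e \<in> space (noise n). dot n ?m e \<ge> \<kappa> * sqrt (dot n ?m ?m)} e \<partial>noise n)"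
      proof (intro nn_integral_mono)
        fix e assume e: "e \<in> space (noise n)"
        have "\<kappa> * sqrt (dot n ?m ?m) \<le> dot n ?m e"
          if "scan_test n p V \<theta> (\<lambda>i\<in>{..<n}. fit X b i + e i, X) = 0"
        proof -
          have "dot n ?w (\<lambda>i\<in>{..<n}. fit X b i + e i) \<le> \<theta> * sqrt (dot n ?w ?w)"
            using that v by (auto simp: scan_test_def not_less split: if_splits)
          then have "dot n ?w (fit X b) + dot n ?w e \<le> \<theta> * sqrt (dot n ?w ?w)"
            by (simp add: dot_restrict_right dot_add_right)
          then show ?thesis using sep[OF True] unfolding neg2 neg by (simp add: algebra_simps)
        qed
        moreover have "scan_test n p V \<theta> z = 0 \<or> scan_test n p V \<theta> z = 1" for z
          by (auto simp: scan_test_def split: prod.splits)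
        ultimately show "ennreal (1 - scan_test n p V \<theta> (\<lambda>i\<in>{..<n}. fit X b i + e i, X))
            \<le> indicator {e \<in> space (noise n). dot n ?m e \<ge> \<kappa> * sqrt (dot n ?m ?m)} e"
          using e by (metis (no_types, lifting) cancel_comm_monoid_add_class.diff_cancel diff_zero ennreal_0 ennreal_1 indicator_simps(1)
              mem_Collect_eq order_refl zero_le)
      qed
      also have "\<dots> = emeasure (noise n) {e \<in> space (noise n). dot n ?m e \<ge> \<kappa> * sqrt (dot n ?m ?m)}"
        by (intro nn_integral_indicator measurable_noise_dot_less)
      also have "\<dots> \<le> ennreal (exp (- \<kappa>\<^sup>2 / 2))"
        using sep[OF True] by (intro noise_tail \<kappa>) (simp add: neg2)
      finally show ?thesis by (simp add: add_increasing)
    qed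
  qed
  also have "\<dots> = emeasure D (space D - G) + ennreal (exp (- \<kappa>\<^sup>2 / 2))"
    using G by (subst nn_integral_add) (auto simp: D.emeasure_space_1)
  also have "\<dots> \<le> ennreal (\<epsilon> + exp (- \<kappa>\<^sup>2 / 2))"
    using G(2) \<open>0 \<le> \<epsilon>\<close> by (subst ennreal_plus) (auto simp: D.emeasure_eq_measure intro!: ennreal_leI)
  finally show ?thesis using \<open>0 \<le> \<epsilon>\<close> by (subst (asm) ennreal_le_iff) auto
qed

text \<open>A threshold at half of the separation \<open>2 * \<theta>\<close> balances the two
  Gaussian exponents at \<open>\<theta>\<^sup>2 / 2\<close>. Both \<open>v\<close> and the good
  event may depend on \<open>b\<close>; only the bound \<open>\<epsilon>\<close> is uniform.\<close>

lemma minimax_risk_upper: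
  assumes V: "finite V" and \<theta>: "0 < \<theta>" and ne: "Xi p s A \<noteq> {}"
    and good: "\<And>b. b \<in> Xi p s A \<Longrightarrow> \<exists>v\<in>V. \<exists>G\<in>sets D. D.prob (space D - G) \<le> \<epsilon> \<and>
      (\<forall>X\<in>G. 0 < dot n (fit X v) (fit X v) \<and>
        2 * \<theta> * sqrt (dot n (fit X v) (fit X v)) \<le> dot n (fit X v) (fit X b))"
  shows "minimax_risk n p D s A \<le> (card V + 1) * exp (- \<theta>\<^sup>2 / 2) + \<epsilon>"
proof -
  have "minimax_risk n p D s A \<le> risk_test n p D s A (scan_test n p V \<theta>)"
    by (intro minimax_risk_le scan_test_in_tests V ne)
  also have "\<dots> \<le> card V * exp (- \<theta>\<^sup>2 / 2) + (\<epsilon> + exp (- \<theta>\<^sup>2 / 2))"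
    unfolding risk_test_def
  proof (intro add_mono cSUP_least scan_test_type_I V \<theta> ne)
    fix b assume "b \<in> Xi p s A"
    from good[OF this] obtain v G where "v \<in> V" "G \<in> sets D" "D.prob (space D - G) \<le> \<epsilon>"
      and "\<forall>X\<in>G. 0 < dot n (fit X v) (fit X v) \<and>
        2 * \<theta> * sqrt (dot n (fit X v) (fit X v)) \<le> dot n (fit X v) (fit X b)" by blast
    then show "(\<integral>\<omega>. 1 - scan_test n p V \<theta> \<omega> \<partial>obs_law n p D b) \<le> \<epsilon> + exp (- \<theta>\<^sup>2 / 2)"
      using V \<theta> by (intro scan_test_type_II[where v=v and G=G]) auto
  qed
  finally show ?thesis by (simp add: algebra_simps)
qed

end

section \<open>Concentration of the design\<close>

text \<open>A second-order Taylor bound valid for both signs, obtained from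
  \<open>1 + x \<le> exp x\<close> alone: through \<open>exp (- y) \<le> 1 / (1 + y)\<close> for
  nonnegative \<open>y\<close>, and by multiplying \<open>exp z * (1 - z) \<le> 1\<close> by
  \<open>1 + z\<close> for \<open>z = - y\<close> otherwise.\<close>

lemma exp_minus_le_quadratic:
  fixes y :: real
  shows "exp (- y) \<le> 1 - y + y\<^sup>2 * exp \<bar>y\<bar>"
proof (cases "0 \<le> y")
  case True
  have "exp (- y) \<le> 1 / (1 + y)"
    using exp_ge_add_one_self[of y] True by (simp add: exp_minus field_simps)
  also have "\<dots> \<le> 1 - y + y\<^sup>2"
  proof -
    have "(1 - y + y\<^sup>2) * (1 + y) = 1 + y ^ 3" by algebra
    then have "1 \<le> (1 - y + y\<^sup>2) * (1 + y)" using True by simp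
    then show ?thesis using True by (simp add: divide_le_eq)
  qed
  also have "\<dots> \<le> 1 - y + y\<^sup>2 * exp \<bar>y\<bar>"
    using mult_left_mono[of 1 "exp \<bar>y\<bar>" "y\<^sup>2"] by simp
  finally show ?thesis .
next
  case False
  define z where "z = - y"
  have z: "0 < z" using False by (simp add: z_def)
  have "exp z * (1 - z) \<le> exp z * exp (- z)"
    using exp_ge_add_one_self[of "-z"] by (intro mult_left_mono) auto
  then have "exp z * (1 - z) \<le> 1" by (simp add: mult_exp_exp)
  then have "exp z * (1 - z) * (1 + z) \<le> 1 * (1 + z)" using z by (intro mult_right_mono) auto
  moreover have "exp z * (1 - z) * (1 + z) = exp z - z\<^sup>2 * exp z" by algebra
  ultimately have "exp z \<le> 1 + z + z\<^sup>2 * exp z" by simp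
  then show ?thesis using z by (simp add: z_def)
qed

text \<open>The linear term is kept exact, so that its expectation is the inner product of the two
  directions. The remainder is pushed into exponentials of squares, which sub-Gaussian variables
  integrate.\<close>

lemma exp_product_bound:
  fixes u v \<kappa> l :: real
  assumes "0 < \<kappa>" "0 \<le> l" "l \<le> \<kappa>"
  shows "exp (- l * (u * v)) \<le> 1 - l * (u * v) + 4 * l\<^sup>2 / \<kappa>\<^sup>2 * (exp (2 * \<kappa> * u\<^sup>2) + exp (2 * \<kappa> * v\<^sup>2))"
proof -
  define w where "w = \<bar>u * v\<bar>"
  have w: "0 \<le> w" "2 * w \<le> u\<^sup>2 + v\<^sup>2"
    using sum_squares_bound[of "\<bar>u\<bar>" "\<bar>v\<bar>"] by (auto simp: w_def abs_mult)
  \<comment> \<open>The exponent budget is \<open>2 * \<kappa> * w\<close>, at most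
    \<open>\<kappa> * (u\<^sup>2 + v\<^sup>2)\<close>: one half pays for the factor
    \<open>w\<^sup>2\<close>, the other for \<open>exp (l * w)\<close>.\<close>
  have "\<kappa> * w \<le> 2 * exp (\<kappa> * w / 2)" using exp_ge_add_one_self[of "\<kappa> * w / 2"] by linarith
  then have "(\<kappa> * w)\<^sup>2 \<le> (2 * exp (\<kappa> * w / 2))\<^sup>2" using assms w by (intro power_mono) auto
  also have "\<dots> = 4 * exp (\<kappa> * w)" by (simp add: power2_eq_square mult_exp_exp)
  finally have kw: "w\<^sup>2 \<le> 4 / \<kappa>\<^sup>2 * exp (\<kappa> * w)" using assms by (simp add: field_simps power_mult_distrib)
  have "exp (\<kappa> * w) * exp (l * w) \<le> exp (\<kappa> * (u\<^sup>2 + v\<^sup>2))"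
  proof -
    have "l * w \<le> \<kappa> * w" using assms w by (intro mult_right_mono) auto
    moreover have "\<kappa> * (2 * w) \<le> \<kappa> * (u\<^sup>2 + v\<^sup>2)" using assms w by (intro mult_left_mono) auto
    ultimately show ?thesis by (simp add: mult_exp_exp)
  qed
  \<comment> \<open>The larger of the two squares dominates their mean, so one summand is already
    enough.\<close>
  also have "\<dots> \<le> exp (2 * \<kappa> * u\<^sup>2) + exp (2 * \<kappa> * v\<^sup>2)"
  proof (cases "u\<^sup>2 \<le> v\<^sup>2")
    case True
    then have "\<kappa> * u\<^sup>2 \<le> \<kappa> * v\<^sup>2" using assms by (intro mult_left_mono) auto
    then have "exp (\<kappa> * (u\<^sup>2 + v\<^sup>2)) \<le> exp (2 * \<kappa> * v\<^sup>2)" by (simp add: algebra_simps)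
    then show ?thesis by (simp add: add_increasing)
  next
    case False
    then have "\<kappa> * v\<^sup>2 \<le> \<kappa> * u\<^sup>2" using assms by (intro mult_left_mono) auto
    then have "exp (\<kappa> * (u\<^sup>2 + v\<^sup>2)) \<le> exp (2 * \<kappa> * u\<^sup>2)" by (simp add: algebra_simps)
    then show ?thesis by (simp add: add_increasing2)
  qed
  finally have ew: "exp (\<kappa> * w) * exp (l * w) \<le> exp (2 * \<kappa> * u\<^sup>2) + exp (2 * \<kappa> * v\<^sup>2)" .
  have "(l * (u * v))\<^sup>2 * exp \<bar>l * (u * v)\<bar> = l\<^sup>2 * (w\<^sup>2 * exp (l * w))"
    using assms by (simp add: w_def power_mult_distrib abs_mult)
  also have "\<dots> \<le> l\<^sup>2 * ((4 / \<kappa>\<^sup>2 * exp (\<kappa> * w)) * exp (l * w))"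
    by (intro mult_left_mono mult_right_mono kw) auto
  also have "\<dots> = 4 * l\<^sup>2 / \<kappa>\<^sup>2 * (exp (\<kappa> * w) * exp (l * w))" by simp
  also have "\<dots> \<le> 4 * l\<^sup>2 / \<kappa>\<^sup>2 * (exp (2 * \<kappa> * u\<^sup>2) + exp (2 * \<kappa> * v\<^sup>2))"
    by (intro mult_left_mono ew) auto
  finally show ?thesis using exp_minus_le_quadratic[of "l * (u * v)"] by simp
qed

text \<open>Integrating the moment generating function bound against a centred Gaussian in \<open>t\<close>
  of variance \<open>1/(2S)\<close> turns \<open>exp (t U)\<close> into \<open>exp (U\<^sup>2/(4S))\<close>.\<close>
lemma subgaussian_exp_square:
  fixes U :: "'a \<Rightarrow> real"
  assumes "prob_space \<mu>" and [measurable]: "U \<in> borel_measurable \<mu>" and S: "0 < S"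
    and mgf: "\<And>t. (\<integral>\<^sup>+x. ennreal (exp (t * U x)) \<partial>\<mu>) \<le> ennreal (exp (S * t\<^sup>2 / 2))"
  shows "(\<integral>\<^sup>+x. ennreal (exp ((U x)\<^sup>2 / (4 * S))) \<partial>\<mu>) \<le> 2"
proof -
  interpret prob_space \<mu> by fact
  interpret P: pair_sigma_finite \<mu> lborel ..
  \<comment> \<open>With this variance \<open>S * t\<^sup>2 / 2\<close> cancels exactly half of the
    Gaussian exponent. What is left is a Gaussian of twice the variance and mass
    \<open>sqrt 2\<close>, which is below 2.\<close>
  define s where "s = sqrt (1 / (2 * S))"
  have s: "0 < s" "s\<^sup>2 = 1 / (2 * S)" using S by (auto simp: s_def)
  let ?\<phi> = "normal_density 0 s"
  have tilt: "?\<phi> t * exp (t * x) = exp (x\<^sup>2 / (4 * S)) * normal_density (s\<^sup>2 * x) s t" for t x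
  proof -
    have "- (t\<^sup>2) / (2 * s\<^sup>2) + t * x = x\<^sup>2 / (4 * S) + - (t - s\<^sup>2 * x)\<^sup>2 / (2 * s\<^sup>2)"
      using S unfolding s(2) by (simp add: field_simps power2_eq_square)
    then show ?thesis by (simp add: normal_density_def mult_exp_exp)
  qed
  have wide: "?\<phi> t * exp (S * t\<^sup>2 / 2) = sqrt 2 * normal_density 0 (s * sqrt 2) t" for t
  proof -
    have "- (t\<^sup>2) / (2 * s\<^sup>2) + S * t\<^sup>2 / 2 = - (t\<^sup>2) / (2 * (s * sqrt 2)\<^sup>2)"
      using S by (simp add: power_mult_distrib s(2) field_simps)
    moreover have "sqrt (2 * pi * (s * sqrt 2)\<^sup>2) = sqrt 2 * sqrt (2 * pi * s\<^sup>2)"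
      by (simp add: power_mult_distrib real_sqrt_mult)
    then have "1 / sqrt (2 * pi * s\<^sup>2) = sqrt 2 * (1 / sqrt (2 * pi * (s * sqrt 2)\<^sup>2))"
      by simp
    ultimately show ?thesis by (simp add: normal_density_def mult_exp_exp)
  qed
  have one: "(\<integral>\<^sup>+t. ennreal (normal_density m r t) \<partial>lborel) = 1" if "0 < r" for m r
    using that by (simp add: nn_integral_eq_integral integrable_normal_density)
  have "(\<integral>\<^sup>+x. ennreal (exp ((U x)\<^sup>2 / (4 * S))) \<partial>\<mu>)
      = (\<integral>\<^sup>+x. (\<integral>\<^sup>+t. ennreal (?\<phi> t) * ennreal (exp (t * U x)) \<partial>lborel) \<partial>\<mu>)"
  proof (intro nn_integral_cong)
    fix x
    have "(\<integral>\<^sup>+t. ennreal (?\<phi> t) * ennreal (exp (t * U x)) \<partial>lborel)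
        = (\<integral>\<^sup>+t. ennreal (exp ((U x)\<^sup>2 / (4 * S))) * ennreal (normal_density (s\<^sup>2 * U x) s t) \<partial>lborel)"
      by (intro nn_integral_cong) (simp add: ennreal_mult[symmetric] tilt)
    also have "\<dots> = ennreal (exp ((U x)\<^sup>2 / (4 * S)))"
      by (subst nn_integral_cmult) (auto simp: one s)
    finally show "ennreal (exp ((U x)\<^sup>2 / (4 * S)))
        = (\<integral>\<^sup>+t. ennreal (?\<phi> t) * ennreal (exp (t * U x)) \<partial>lborel)" ..
  qed
  also have "\<dots> = (\<integral>\<^sup>+t. (\<integral>\<^sup>+x. ennreal (?\<phi> t) * ennreal (exp (t * U x)) \<partial>\<mu>) \<partial>lborel)"
    by (rule P.Fubini'[symmetric]) measurable
  also have "\<dots> \<le> (\<integral>\<^sup>+t. ennreal (?\<phi> t) * ennreal (exp (S * t\<^sup>2 / 2)) \<partial>lborel)"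
    by (intro nn_integral_mono) (auto simp: nn_integral_cmult intro!: mult_left_mono mgf)
  also have "\<dots> = (\<integral>\<^sup>+t. ennreal (sqrt 2) * ennreal (normal_density 0 (s * sqrt 2) t) \<partial>lborel)"
    by (intro nn_integral_cong) (simp add: ennreal_mult[symmetric] wide)
  also have "\<dots> = ennreal (sqrt 2)"
    using s by (subst nn_integral_cmult) (auto simp: one)
  also have "\<dots> \<le> ennreal 2"
    by (intro ennreal_leI) (simp add: real_le_lsqrt)
  finally show ?thesis by simp
qed

section \<open>Moment bounds for one sub-Gaussian row\<close>

lemma measurable_dot_row[measurable]: "dot p a \<in> borel_measurable (vec_space p)"
proof -
  have "(\<lambda>x. dot p a x) \<in> borel_measurable (vec_space p)"
    by (intro measurable_dot) auto
  then show ?thesis by simp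
qed

text \<open>\<open>S\<close> enlarges the variance proxy \<open>\<sigma>2\<close> to at least 1: the
  moment generating function bound only weakens, division by \<open>S\<close> is safe, and
  \<open>S\<close> is at most its square.\<close>

locale subG =
  fixes p :: nat and \<sigma>2 S :: real and \<mu> :: "(nat \<Rightarrow> real) measure"
  assumes row: "subG_row p \<sigma>2 \<mu>" and S: "1 \<le> S" "\<sigma>2 \<le> S"
begin

lemma prob_space_row: "prob_space \<mu>" and sets_row: "sets \<mu> = sets (vec_space p)"
  using row by (auto simp: subG_row_def)

sublocale prob_space \<mu> by (rule prob_space_row)

declare sets_row[measurable_cong]

lemma measurable_row_dot[measurable]: "dot p a \<in> borel_measurable \<mu>"
  by (simp add: measurable_cong_sets[OF sets_row refl])

lemma row_second_moment:
  "integrable \<mu> (\<lambda>x. dot p a x * dot p b x)"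
  "(\<integral>x. dot p a x * dot p b x \<partial>\<mu>) = dot p a b"
proof -
  have I: "integrable \<mu> (\<lambda>x. x j * x k)" "(\<integral>x. x j * x k \<partial>\<mu>) = (if j = k then 1 else 0)"
    if "j < p" "k < p" for j k
    using row that by (auto simp: subG_row_def)
  have eq: "dot p a x * dot p b x = (\<Sum>j<p. \<Sum>k<p. (a j * b k) * (x j * x k))" for x
    unfolding dot_def sum_product by (intro sum.cong) auto
  show "integrable \<mu> (\<lambda>x. dot p a x * dot p b x)"
    unfolding eq by (intro Bochner_Integration.integrable_sum integrable_mult_right I) auto
  have "(\<integral>x. dot p a x * dot p b x \<partial>\<mu>) = (\<Sum>j<p. \<Sum>k<p. (a j * b k) * (\<integral>x. x j * x k \<partial>\<mu>))"
    unfolding eq using I(1)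
    by (subst Bochner_Integration.integral_sum; (intro Bochner_Integration.integrable_sum integrable_mult_right I; simp)?)
       (intro sum.cong refl, subst Bochner_Integration.integral_sum; auto)
  also have "\<dots> = (\<Sum>j<p. \<Sum>k<p. if j = k then a j * b k else 0)"
    using I(2) by (intro sum.cong refl) auto
  also have "\<dots> = dot p a b"
    unfolding dot_def by (intro sum.cong refl) (simp add: sum.delta)
  finally show "(\<integral>x. dot p a x * dot p b x \<partial>\<mu>) = dot p a b" .
qed

lemma row_exp_square:
  assumes "dot p a a = 1"
  shows "(\<integral>\<^sup>+x. ennreal (exp ((dot p a x)\<^sup>2 / (4 * S))) \<partial>\<mu>) \<le> 2"
proof (rule subgaussian_exp_square)
  fix t
  have "(\<integral>\<^sup>+x. ennreal (exp (t * dot p a x)) \<partial>\<mu>) \<le> ennreal (exp (\<sigma>2 * t\<^sup>2 / 2))"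
    using row assms unfolding subG_row_def dot_def by (simp add: power2_eq_square)
  also have "\<dots> \<le> ennreal (exp (S * t\<^sup>2 / 2))"
    using S by (intro ennreal_leI) (simp add: mult_right_mono)
  finally show "(\<integral>\<^sup>+x. ennreal (exp (t * dot p a x)) \<partial>\<mu>) \<le> ennreal (exp (S * t\<^sup>2 / 2))" .
qed (use S in \<open>auto intro: prob_space_row\<close>)

text \<open>Isotropy makes the first-order term exactly \<open>- l * dot p a b\<close>. The range of
  \<open>l\<close> ends at \<open>\<kappa> = 1 / (8 * S)\<close>, for which the remainder of
  \<open>exp_product_bound\<close> contains precisely the exponential squares of
  \<open>row_exp_square\<close>.\<close>

lemma row_product_mgf:
  assumes a: "dot p a a = 1" and b: "dot p b b = 1" and l: "0 \<le> l" "l \<le> 1 / (8 * S)"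
  shows "(\<integral>\<^sup>+x. ennreal (exp (- l * (dot p a x * dot p b x))) \<partial>\<mu>)
    \<le> ennreal (exp (- l * dot p a b + 1024 * S\<^sup>2 * l\<^sup>2))"
proof -
  define \<kappa> where "\<kappa> = 1 / (8 * S)"
  have \<kappa>: "0 < \<kappa>" using S by (simp add: \<kappa>_def)
  have Q: "integrable \<mu> (\<lambda>x. exp (2 * \<kappa> * (dot p c x)\<^sup>2))" "(\<integral>x. exp (2 * \<kappa> * (dot p c x)\<^sup>2) \<partial>\<mu>) \<le> 2"
    if c: "dot p c c = 1" for c
  proof -
    have eq: "2 * \<kappa> * y = y / (4 * S)" for y by (simp add: \<kappa>_def)
    have le: "(\<integral>\<^sup>+x. ennreal (exp (2 * \<kappa> * (dot p c x)\<^sup>2)) \<partial>\<mu>) \<le> 2"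
      unfolding eq by (rule row_exp_square[OF c])
    then show int: "integrable \<mu> (\<lambda>x. exp (2 * \<kappa> * (dot p c x)\<^sup>2))"
      by (intro integrableI_nonneg) (auto simp: le_less_trans[OF _ ennreal_numeral_less_top])
    have "ennreal (\<integral>x. exp (2 * \<kappa> * (dot p c x)\<^sup>2) \<partial>\<mu>) \<le> ennreal 2"
      using le by (subst nn_integral_eq_integral[OF int, symmetric]) auto
    then show "(\<integral>x. exp (2 * \<kappa> * (dot p c x)\<^sup>2) \<partial>\<mu>) \<le> 2" by (subst (asm) ennreal_le_iff) auto
  qed
  let ?R = "\<lambda>x. 1 - l * (dot p a x * dot p b x)
    + 4 * l\<^sup>2 / \<kappa>\<^sup>2 * (exp (2 * \<kappa> * (dot p a x)\<^sup>2) + exp (2 * \<kappa> * (dot p b x)\<^sup>2))"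
  have R: "exp (- l * (dot p a x * dot p b x)) \<le> ?R x" for x
    using l \<kappa> by (intro exp_product_bound) (auto simp: \<kappa>_def)
  \<comment> \<open>The majorant dominates an exponential; its nonnegativity allows passing from the
    nonnegative integral to the signed one, where the linear term can be evaluated.\<close>
  have R0: "0 \<le> ?R x" for x using order_trans[OF _ R] by simp
  have int: "integrable \<mu> ?R" using row_second_moment(1)[of a b] Q(1)[OF a] Q(1)[OF b] by auto
  have "(\<integral>\<^sup>+x. ennreal (exp (- l * (dot p a x * dot p b x))) \<partial>\<mu>) \<le> (\<integral>\<^sup>+x. ennreal (?R x) \<partial>\<mu>)"
    by (intro nn_integral_mono ennreal_leI R)
  also have "\<dots> = ennreal (\<integral>x. ?R x \<partial>\<mu>)" using R0 by (intro nn_integral_eq_integral int) auto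
  also have "(\<integral>x. ?R x \<partial>\<mu>) = 1 - l * dot p a b + 4 * l\<^sup>2 / \<kappa>\<^sup>2 *
      ((\<integral>x. exp (2 * \<kappa> * (dot p a x)\<^sup>2) \<partial>\<mu>) + (\<integral>x. exp (2 * \<kappa> * (dot p b x)\<^sup>2) \<partial>\<mu>))"
    using row_second_moment[of a b] Q(1)[OF a] Q(1)[OF b] by (simp add: prob_space)
  also have "ennreal \<dots> \<le> ennreal (exp (- l * dot p a b + 1024 * S\<^sup>2 * l\<^sup>2))"
  proof (intro ennreal_leI)
    have "4 * l\<^sup>2 / \<kappa>\<^sup>2 * ((\<integral>x. exp (2 * \<kappa> * (dot p a x)\<^sup>2) \<partial>\<mu>) + (\<integral>x. exp (2 * \<kappa> * (dot p b x)\<^sup>2) \<partial>\<mu>))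
        \<le> 4 * l\<^sup>2 / \<kappa>\<^sup>2 * (2 + 2)"
      by (intro mult_left_mono add_mono Q a b) auto
    \<comment> \<open>The constant is 4 from the remainder, times 64 from
      \<open>1 / \<kappa>\<^sup>2\<close>, times 4 from two expectations of at most 2.\<close>
    also have "\<dots> = 1024 * S\<^sup>2 * l\<^sup>2"
      by (simp add: \<kappa>_def power_divide power_mult_distrib)
    finally show "1 - l * dot p a b + 4 * l\<^sup>2 / \<kappa>\<^sup>2 *
      ((\<integral>x. exp (2 * \<kappa> * (dot p a x)\<^sup>2) \<partial>\<mu>) + (\<integral>x. exp (2 * \<kappa> * (dot p b x)\<^sup>2) \<partial>\<mu>))
      \<le> exp (- l * dot p a b + 1024 * S\<^sup>2 * l\<^sup>2)"
      using exp_ge_add_one_self[of "- l * dot p a b + 1024 * S\<^sup>2 * l\<^sup>2"] by linarith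
  qed
  finally show ?thesis .
qed

end

section \<open>Concentration for a matrix with independent sub-Gaussian rows\<close>

locale subG_matrix = subG +
  fixes n :: nat
begin

abbreviation "D \<equiv> PiM {..<n} (\<lambda>_. \<mu>)"

sublocale design n p D
proof (rule design.intro)
  show "prob_space D" by (intro prob_space_PiM prob_space_row)
  show "sets D = sets (mat_space n p)"
    unfolding mat_space_def by (intro sets_PiM_cong sets_row) auto
qed

sublocale product: product_prob_space "\<lambda>_::nat. \<mu>"
  by unfold_locales

lemma fit_row: "fit X a i = dot p a (X i)"
  by (simp add: mat_vec_def dot_def mult.commute)

lemma design_second_moment:
  "integrable D (\<lambda>X. dot n (fit X b) (fit X b))"
  "(\<integral>X. dot n (fit X b) (fit X b) \<partial>D) = real n * dot p b b"
proof -
  let ?g = "\<lambda>x. dot p b x * dot p b x"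
  have eq: "dot n (fit X b) (fit X b) = (\<Sum>i<n. ?g (X i))" for X
    by (simp add: dot_def[of n] fit_row)
  have comp: "distr D \<mu> (\<lambda>X. X i) = \<mu>" if "i < n" for i
    using that by (intro distr_PiM_component prob_space_row) auto
  have m: "(\<lambda>X. X i) \<in> measurable D \<mu>" if "i < n" for i using that by simp
  have i1: "integrable D (\<lambda>X. ?g (X i))" if "i < n" for i
    using row_second_moment(1)[of b b] by (subst (asm) comp[OF that, symmetric]) (simp add: integrable_distr_eq m[OF that])
  have e1: "(\<integral>X. ?g (X i) \<partial>D) = dot p b b" if "i < n" for i
    using row_second_moment(2)[of b b] by (subst (asm) comp[OF that, symmetric]) (simp add: integral_distr m[OF that])
  show "integrable D (\<lambda>X. dot n (fit X b) (fit X b))"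
    unfolding eq using i1 by (intro Bochner_Integration.integrable_sum) auto
  show "(\<integral>X. dot n (fit X b) (fit X b) \<partial>D) = real n * dot p b b"
    unfolding eq using i1 e1 by (subst Bochner_Integration.integral_sum) auto
qed

lemma design_product_mgf:
  assumes "dot p a a = 1" "dot p b b = 1" "0 \<le> l" "l \<le> 1 / (8 * S)"
  shows "(\<integral>\<^sup>+X. ennreal (exp (- l * dot n (fit X a) (fit X b))) \<partial>D)
    \<le> ennreal (exp (real n * (- l * dot p a b + 1024 * S\<^sup>2 * l\<^sup>2)))"
proof -
  have "(\<integral>\<^sup>+X. ennreal (exp (- l * dot n (fit X a) (fit X b))) \<partial>D)
      = (\<integral>\<^sup>+X. (\<Prod>i<n. ennreal (exp (- l * (dot p a (X i) * dot p b (X i))))) \<partial>D)"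
    by (intro nn_integral_cong)
      (simp add: prod_ennreal exp_sum[symmetric] dot_def[of n] fit_row sum_distrib_left sum_negf)
  also have "\<dots> = (\<Prod>i<n. \<integral>\<^sup>+x. ennreal (exp (- l * (dot p a x * dot p b x))) \<partial>\<mu>)"
    by (intro product.product_nn_integral_prod) auto
  also have "\<dots> \<le> (\<Prod>i<n. ennreal (exp (- l * dot p a b + 1024 * S\<^sup>2 * l\<^sup>2)))"
    using row_product_mgf[OF assms] by (simp add: power_mono_ennreal)
  also have "\<dots> = ennreal (exp (real n * (- l * dot p a b + 1024 * S\<^sup>2 * l\<^sup>2)))"
    by (simp add: ennreal_power exp_of_nat_mult)
  finally show ?thesis .
qed

text \<open>Chernoff's method for a sum over independent rows. Only the lower tail is treated;
  replacing one vector by its negative gives the upper one.\<close>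

lemma design_product_tail:
  assumes a: "dot p a a = 1" and b: "dot p b b = 1" and r: "0 \<le> r" "r \<le> 1"
  shows "D.prob {X \<in> space D. dot n (fit X a) (fit X b) \<le> real n * (dot p a b - r)}
    \<le> exp (- real n * r\<^sup>2 / (4096 * S\<^sup>2))"
proof -
  \<comment> \<open>The minimiser of \<open>1024 * S\<^sup>2 * l\<^sup>2 - l * r\<close>, with
    minimum \<open>- r\<^sup>2 / (4096 * S\<^sup>2)\<close>. Since \<open>r\<close> is at most 1 and
    \<open>S\<close> at least 1, it stays in the admissible range of \<open>l\<close>.\<close>
  define l where "l = r / (2048 * S\<^sup>2)"
  have "1 \<le> S\<^sup>2" using S by (simp add: one_le_power)
  have l: "0 \<le> l" using r by (simp add: l_def)
  have "8 * S \<le> 2048 * S\<^sup>2"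
    using mult_left_mono[of 1 S S] S by (simp add: power2_eq_square)
  then have "r * (8 * S) \<le> 1 * (2048 * S\<^sup>2)"
    by (rule mult_mono[OF r(2)]) (use S in auto)
  then have l8: "l \<le> 1 / (8 * S)" using S by (simp add: l_def field_simps)
  let ?E = "{X \<in> space D. dot n (fit X a) (fit X b) \<le> real n * (dot p a b - r)}"
  let ?c = "l * (real n * (dot p a b - r))"
  have E: "?E \<in> sets D" using measurable_fit_dot[of a b] by measurable
  have "emeasure D ?E = (\<integral>\<^sup>+X. indicator ?E X \<partial>D)" using E by simp
  also have "\<dots> \<le> (\<integral>\<^sup>+X. ennreal (exp ?c) * ennreal (exp (- l * dot n (fit X a) (fit X b))) \<partial>D)"
  proof (intro nn_integral_mono)
    fix X
    have "1 \<le> exp ?c * exp (- l * dot n (fit X a) (fit X b))" if "X \<in> ?E"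
    proof -
      have "l * dot n (fit X a) (fit X b) \<le> ?c" using that l by (intro mult_left_mono) auto
      then show ?thesis by (simp add: mult_exp_exp)
    qed
    then show "indicator ?E X \<le> ennreal (exp ?c) * ennreal (exp (- l * dot n (fit X a) (fit X b)))"
      by (auto simp: ennreal_mult[symmetric] simp del: mult_minus_left split: split_indicator)
  qed
  also have "\<dots> = ennreal (exp ?c) * (\<integral>\<^sup>+X. ennreal (exp (- l * dot n (fit X a) (fit X b))) \<partial>D)"
    using measurable_fit_dot[of a b] by (intro nn_integral_cmult) measurable
  also have "\<dots> \<le> ennreal (exp ?c) * ennreal (exp (real n * (- l * dot p a b + 1024 * S\<^sup>2 * l\<^sup>2)))"
    by (intro mult_left_mono design_product_mgf a b l l8) auto
  also have "\<dots> = ennreal (exp (- real n * r\<^sup>2 / (4096 * S\<^sup>2)))"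
  proof -
    have "1024 * S\<^sup>2 * l\<^sup>2 - l * r = - r\<^sup>2 / (4096 * S\<^sup>2)"
      using \<open>1 \<le> S\<^sup>2\<close> S by (simp add: l_def power_divide field_simps power2_eq_square)
    then have "real n * (1024 * S\<^sup>2 * l\<^sup>2 - l * r) = - real n * r\<^sup>2 / (4096 * S\<^sup>2)" by simp
    moreover have "?c + real n * (- l * dot p a b + 1024 * S\<^sup>2 * l\<^sup>2) = real n * (1024 * S\<^sup>2 * l\<^sup>2 - l * r)"
      by (simp add: algebra_simps)
    ultimately show ?thesis by (simp only: ennreal_mult[symmetric] exp_ge_zero mult_exp_exp)
  qed
  finally show ?thesis
    unfolding D.emeasure_eq_measure by (subst (asm) ennreal_le_iff) auto
qed

lemma fit_scale: "fit X (\<lambda>j. c * a j) = (\<lambda>i. c * fit X a i)"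
  by (auto simp: mat_vec_def sum_distrib_left algebra_simps)

text \<open>After normalising, \<open>a\<close> and \<open>c\<close> are unit vectors whose inner
  product is at least \<open>1 / sqrt s\<close>. A relative error \<open>\<eta>\<close> for it
  therefore allows an absolute error \<open>r = \<eta> / sqrt s\<close>, and the square of
  \<open>r\<close> puts \<open>s\<close> into the denominator of the rate.\<close>

lemma design_good_event:
  assumes v: "0 < dot p v v" and b: "0 < dot p b b" and s: "1 \<le> s"
    and corr: "sqrt (dot p v v) * sqrt (dot p b b) \<le> sqrt s * dot p v b"
    and \<eta>: "0 < \<eta>" "\<eta> \<le> 1"
  shows "\<exists>G\<in>sets D. D.prob (space D - G) \<le> 2 * exp (- real n * \<eta>\<^sup>2 / (4096 * S\<^sup>2 * s)) \<and>
    (\<forall>X\<in>G. (1 - \<eta>) * real n * dot p v b < dot n (fit X v) (fit X b) \<and>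
           dot n (fit X v) (fit X v) < (1 + \<eta>) * real n * dot p v v)"
proof -
  define nv nb where "nv = sqrt (dot p v v)" and "nb = sqrt (dot p b b)"
  have nv: "0 < nv" "nv\<^sup>2 = dot p v v" and nb: "0 < nb" "nb\<^sup>2 = dot p b b"
    using v b by (auto simp: nv_def nb_def)
  \<comment> \<open>The vector \<open>d\<close> is \<open>- a\<close>, so that the lower tail for
    the pair \<open>a\<close>, \<open>d\<close> controls \<open>|X v|^2\<close> from above.\<close>
  define a c d where "a = (\<lambda>j. 1 / nv * v j)" and "c = (\<lambda>j. 1 / nb * b j)" and "d = (\<lambda>j. - 1 / nv * v j)"
  have unit: "dot p a a = 1" "dot p c c = 1" "dot p d d = 1"
    unfolding a_def c_def d_def dot_scale_left dot_scale_right
    unfolding nv(2)[symmetric] nb(2)[symmetric] using nv(1) nb(1) by (simp_all add: power2_eq_square)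
  have ac: "dot p a c = dot p v b / (nv * nb)" and ad: "dot p a d = - 1"
    unfolding a_def c_def d_def dot_scale_left dot_scale_right
    unfolding nv(2)[symmetric] using nv(1) by (simp_all add: power2_eq_square)
  have fac: "dot n (fit X a) (fit X c) = dot n (fit X v) (fit X b) / (nv * nb)" for X
    unfolding a_def c_def fit_scale dot_scale_left dot_scale_right by simp
  have fad: "dot n (fit X a) (fit X d) = - dot n (fit X v) (fit X v) / (nv * nv)" for X
    unfolding a_def d_def fit_scale dot_scale_left dot_scale_right by simp
  define r where "r = \<eta> / sqrt s"
  have ss: "1 \<le> sqrt s" using s by simp
  have "\<eta> \<le> sqrt s" using ss \<eta> by linarith
  then have r: "0 \<le> r" "r \<le> 1" using s \<eta> by (auto simp: r_def divide_le_eq)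
  have r2: "r\<^sup>2 = \<eta>\<^sup>2 / s" using s by (simp add: r_def power_divide)
  have "1 / sqrt s \<le> dot p a c"
    using corr nv(1) nb(1) ss unfolding ac nv_def[symmetric] nb_def[symmetric] by (simp add: field_simps)
  then have "\<eta> * (1 / sqrt s) \<le> \<eta> * dot p a c" using \<eta> by (intro mult_left_mono) auto
  then have rac: "r \<le> \<eta> * dot p a c" by (simp add: r_def)
  have r\<eta>: "r \<le> \<eta>" using ss \<eta> by (simp add: r_def divide_le_eq)
  let ?B1 = "{X \<in> space D. dot n (fit X a) (fit X c) \<le> real n * (dot p a c - r)}"
  let ?B2 = "{X \<in> space D. dot n (fit X a) (fit X d) \<le> real n * (dot p a d - r)}"
  have B: "?B1 \<in> sets D" "?B2 \<in> sets D"
    using measurable_fit_dot[of a c] measurable_fit_dot[of a d] by measurable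
  let ?G = "space D - (?B1 \<union> ?B2)"
  have "D.prob (space D - ?G) = D.prob (?B1 \<union> ?B2)" by (intro arg_cong[where f=D.prob]) auto
  also have "\<dots> \<le> D.prob ?B1 + D.prob ?B2" using B by (intro measure_Un_le)
  also have "\<dots> \<le> exp (- real n * r\<^sup>2 / (4096 * S\<^sup>2)) + exp (- real n * r\<^sup>2 / (4096 * S\<^sup>2))"
    by (intro add_mono design_product_tail unit r)
  also have "\<dots> = 2 * exp (- real n * \<eta>\<^sup>2 / (4096 * S\<^sup>2 * s))"
    unfolding r2 by (simp add: mult.commute)
  finally have P: "D.prob (space D - ?G) \<le> 2 * exp (- real n * \<eta>\<^sup>2 / (4096 * S\<^sup>2 * s))" .
  have "(1 - \<eta>) * real n * dot p v b < dot n (fit X v) (fit X b) \<and>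
      dot n (fit X v) (fit X v) < (1 + \<eta>) * real n * dot p v v" if X: "X \<in> ?G" for X
  proof
    have "real n * ((1 - \<eta>) * dot p a c) \<le> real n * (dot p a c - r)"
      using rac by (intro mult_left_mono) (auto simp: algebra_simps)
    also have "\<dots> < dot n (fit X a) (fit X c)" using X by auto
    finally have "(1 - \<eta>) * real n * dot p v b / (nv * nb) < dot n (fit X v) (fit X b) / (nv * nb)"
      unfolding ac fac by (simp add: mult.assoc mult.left_commute)
    then show "(1 - \<eta>) * real n * dot p v b < dot n (fit X v) (fit X b)"
      using mult_pos_pos[OF nv(1) nb(1)] by (subst (asm) divide_less_cancel) auto
    have "real n * (- (1 + \<eta>)) \<le> real n * (dot p a d - r)"
      using r\<eta> unfolding ad by (intro mult_left_mono) auto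
    also have "\<dots> < dot n (fit X a) (fit X d)" using X by auto
    finally have "dot n (fit X v) (fit X v) / (nv * nv) < real n * (1 + \<eta>)"
      unfolding fad by (simp only: mult_minus_right minus_divide_left[symmetric] neg_less_iff_less)
    then have "dot n (fit X v) (fit X v) < real n * (1 + \<eta>) * (nv * nv)"
      using nv by (simp add: divide_less_eq)
    then show "dot n (fit X v) (fit X v) < (1 + \<eta>) * real n * dot p v v"
      unfolding nv(2)[symmetric] power2_eq_square by (simp add: mult.assoc mult.left_commute)
  qed
  moreover have "?G \<in> sets D" using B by auto
  ultimately show ?thesis using P by (intro bexI[of _ ?G]) auto
qed

end

section \<open>A common interface for the two design classes\<close>

text \<open>The rate \<open>\<kappa>\<close> is proportional to \<open>n\<close> for sub-Gaussian rows; for an orthogonal design the good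
  event has probability one and \<open>\<kappa>\<close> is arbitrary.\<close>

locale concentrated_design = design +
  fixes \<kappa> :: real
  assumes second_moment:
      "\<And>b. integrable D (\<lambda>X. dot n (fit X b) (fit X b))"
      "\<And>b. (\<integral>X. dot n (fit X b) (fit X b) \<partial>D) = real n * dot p b b"
    and good_event: "\<And>v b s \<eta>. \<lbrakk>0 < dot p v v; 0 < dot p b b; 1 \<le> s;
        sqrt (dot p v v) * sqrt (dot p b b) \<le> sqrt s * dot p v b; 0 < \<eta>; \<eta> \<le> 1\<rbrakk> \<Longrightarrow>
      \<exists>G\<in>sets D. D.prob (space D - G) \<le> 2 * exp (- \<kappa> * \<eta>\<^sup>2 / s) \<and>
        (\<forall>X\<in>G. (1 - \<eta>) * real n * dot p v b < dot n (fit X v) (fit X b) \<and>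
               dot n (fit X v) (fit X v) < (1 + \<eta>) * real n * dot p v v)"

lemma concentrated_design_subG:
  assumes "subG_design n p \<sigma>2 D" "1 \<le> S" "\<sigma>2 \<le> S"
  shows "concentrated_design n p D (real n / (4096 * S\<^sup>2))"
proof -
  obtain \<mu> where \<mu>: "subG_row p \<sigma>2 \<mu>" "D = PiM {..<n} (\<lambda>_. \<mu>)"
    using assms(1) by (auto simp: subG_design_def)
  interpret subG_matrix p \<sigma>2 S \<mu> n
    using \<mu>(1) assms by unfold_locales
  show ?thesis
    unfolding \<mu>(2)
  proof unfold_locales
    fix b
    show "integrable (PiM {..<n} (\<lambda>_. \<mu>)) (\<lambda>X. dot n (fit X b) (fit X b))"
      "(\<integral>X. dot n (fit X b) (fit X b) \<partial>PiM {..<n} (\<lambda>_. \<mu>)) = real n * dot p b b"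
      by (fact design_second_moment)+
  next
    fix v b :: "nat \<Rightarrow> real" and s \<eta> :: real
    assume "0 < dot p v v" "0 < dot p b b" "1 \<le> s"
      "sqrt (dot p v v) * sqrt (dot p b b) \<le> sqrt s * dot p v b" "0 < \<eta>" "\<eta> \<le> 1"
    from design_good_event[OF this]
    show "\<exists>G\<in>sets (PiM {..<n} (\<lambda>_. \<mu>)). D.prob (space (PiM {..<n} (\<lambda>_. \<mu>)) - G)
          \<le> 2 * exp (- (real n / (4096 * S\<^sup>2)) * \<eta>\<^sup>2 / s) \<and>
        (\<forall>X\<in>G. (1 - \<eta>) * real n * dot p v b < dot n (fit X v) (fit X b) \<and>
               dot n (fit X v) (fit X v) < (1 + \<eta>) * real n * dot p v v)"
      by (simp add: divide_divide_eq_left)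
  qed
qed

lemma orth_dot:
  assumes "\<forall>j<p. \<forall>k<p. (\<Sum>i<n. X i j * X i k) = (if j = k then real n else 0)"
  shows "dot n (mat_vec p X v) (mat_vec p X b) = real n * dot p v b"
proof -
  have "dot n (mat_vec p X v) (mat_vec p X b) = (\<Sum>i<n. \<Sum>j<p. \<Sum>k<p. v j * b k * (X i j * X i k))"
    unfolding dot_def mat_vec_def sum_product by (intro sum.cong refl) (simp add: mult_ac)
  also have "\<dots> = (\<Sum>j<p. \<Sum>i<n. \<Sum>k<p. v j * b k * (X i j * X i k))" by (rule sum.swap)
  also have "\<dots> = (\<Sum>j<p. \<Sum>k<p. \<Sum>i<n. v j * b k * (X i j * X i k))"
    by (intro sum.cong refl sum.swap)
  also have "\<dots> = (\<Sum>j<p. \<Sum>k<p. v j * b k * (if j = k then real n else 0))"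
    using assms by (intro sum.cong refl) (simp add: sum_distrib_left[symmetric])
  also have "\<dots> = (\<Sum>j<p. \<Sum>k<p. if j = k then real n * (v j * b k) else 0)"
    by (intro sum.cong refl) simp
  also have "\<dots> = real n * dot p v b"
    by (simp add: dot_def sum_distrib_left)
  finally show ?thesis .
qed

lemma concentrated_design_orth:
  assumes orth: "orth_design n p D" and n: "0 < n"
  shows "concentrated_design n p D \<kappa>"
proof -
  interpret design n p D using orth by (intro design.intro) (auto simp: orth_design_def)
  have "AE X in D. \<forall>j<p. \<forall>k<p. (\<Sum>i<n. X i j * X i k) = (if j = k then real n else 0)"
    using orth by (simp add: orth_design_def)
  then have AE: "AE X in D. \<forall>v b. dot n (fit X v) (fit X b) = real n * dot p v b"
    by eventually_elim (simp add: orth_dot)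
  have AE': "AE X in D. dot n (fit X v) (fit X b) = real n * dot p v b" for v b
    using AE by eventually_elim blast
  show ?thesis
  proof unfold_locales
    fix b
    have "integrable D (\<lambda>X. real n * dot p b b)" by simp
    then show "integrable D (\<lambda>X. dot n (fit X b) (fit X b))"
      using AE'[of b b] by (subst integrable_cong_AE[where g="\<lambda>_. real n * dot p b b"]) (auto intro: measurable_fit_dot)
    have "(\<integral>X. dot n (fit X b) (fit X b) \<partial>D) = (\<integral>X. real n * dot p b b \<partial>D)"
      using AE'[of b b] by (intro integral_cong_AE measurable_fit_dot) auto
    then show "(\<integral>X. dot n (fit X b) (fit X b) \<partial>D) = real n * dot p b b"
      by (simp add: D.prob_space)
  next
    fix v b :: "nat \<Rightarrow> real" and s \<eta> :: real
    assume v: "0 < dot p v v" and b: "0 < dot p b b" and s: "1 \<le> s"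
      and corr: "sqrt (dot p v v) * sqrt (dot p b b) \<le> sqrt s * dot p v b" and \<eta>: "0 < \<eta>" "\<eta> \<le> 1"
    \<comment> \<open>The correlation condition forces \<open>dot p v b\<close> to be positive;
      without this \<open>(1 - \<eta>)\<close> times the mean would not lie strictly below the
      mean.\<close>
    have "0 < sqrt (dot p v v) * sqrt (dot p b b)" using v b by simp
    then have "0 < sqrt s * dot p v b" using corr by linarith
    then have vb: "0 < dot p v b" using s by (simp add: zero_less_mult_iff)
    \<comment> \<open>Recording only the two identities for the given \<open>v\<close> and
      \<open>b\<close> keeps the event measurable; the almost sure statement quantifies over
      uncountably many vectors.\<close>
    let ?G = "{X \<in> space D. dot n (fit X v) (fit X b) = real n * dot p v b \<and>
      dot n (fit X v) (fit X v) = real n * dot p v v}"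
    have G: "?G \<in> sets D"
      using measurable_fit_dot[of v b] measurable_fit_dot[of v v] by measurable
    have "AE X in D. X \<in> ?G" using AE AE_space by eventually_elim auto
    then have "D.prob ?G = 1" using G by (subst D.prob_eq_1) auto
    then have "D.prob (space D - ?G) = 0" using G by (simp add: D.prob_compl)
    moreover have "(1 - \<eta>) * real n * dot p v b < real n * dot p v b"
      "real n * dot p v v < (1 + \<eta>) * real n * dot p v v"
      using n v vb \<eta> by (auto simp: algebra_simps)
    ultimately show "\<exists>G\<in>sets D. D.prob (space D - G) \<le> 2 * exp (- \<kappa> * \<eta>\<^sup>2 / s) \<and>
        (\<forall>X\<in>G. (1 - \<eta>) * real n * dot p v b < dot n (fit X v) (fit X b) \<and>
               dot n (fit X v) (fit X v) < (1 + \<eta>) * real n * dot p v v)"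
      using G by (intro bexI[of _ ?G]) auto
  qed
qed

section \<open>Sign patterns and geometry of the signal class\<close>

text \<open>Lists with repeated or conflicting entries give vectors that are not sign patterns of size \<open>s\<close>;
  they are harmless because the type I error only sees the number of vectors.\<close>

definition signed_vec :: "real \<Rightarrow> (nat \<times> bool) list \<Rightarrow> nat \<Rightarrow> real" where
  "signed_vec A l j = (if (j, True) \<in> set l then A else if (j, False) \<in> set l then - A else 0)"

definition signed_vecs :: "nat \<Rightarrow> nat \<Rightarrow> real \<Rightarrow> (nat \<Rightarrow> real) set" where
  "signed_vecs p s A = signed_vec A ` {l. set l \<subseteq> {..<p} \<times> UNIV \<and> length l = s}"

lemma finite_signed_vecs: "finite (signed_vecs p s A)"
  unfolding signed_vecs_def by (intro finite_imageI finite_lists_length_eq) auto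

lemma card_signed_vecs: "card (signed_vecs p s A) \<le> (2 * p) ^ s"
proof -
  have "card (signed_vecs p s A) \<le> card {l. set l \<subseteq> {..<p} \<times> (UNIV :: bool set) \<and> length l = s}"
    unfolding signed_vecs_def by (intro card_image_le finite_lists_length_eq) auto
  also have "\<dots> = (2 * p) ^ s"
    by (subst card_lists_length_eq) (auto simp: card_cartesian_product mult.commute)
  finally show ?thesis .
qed

lemma sign_pattern_in_signed_vecs:
  assumes "b \<in> Xi p s A"
  shows "(\<lambda>j. if b j = 0 then 0 else A * sgn (b j)) \<in> signed_vecs p s A"
proof -
  let ?S = "{i \<in> {..<p}. b i \<noteq> 0}"
  let ?l = "map (\<lambda>j. (j, 0 < b j)) (sorted_list_of_set ?S)"
  have out: "b i = 0" if "p \<le> i" for i using assms that by (simp add: Xi_def)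
  have "set ?l = (\<lambda>j. (j, 0 < b j)) ` ?S" by simp
  then have mem: "(j, c) \<in> set ?l \<longleftrightarrow> b j \<noteq> 0 \<and> c = (0 < b j)" for j c
    using out[of j] by (auto simp: not_le[symmetric])
  have "length ?l = s" using assms by (simp add: Xi_def)
  moreover have "set ?l \<subseteq> {..<p} \<times> UNIV" by auto
  moreover have "(\<lambda>j. if b j = 0 then 0 else A * sgn (b j)) = signed_vec A ?l"
  proof
    fix j
    show "(if b j = 0 then 0 else A * sgn (b j)) = signed_vec A ?l j"
      unfolding signed_vec_def mem by (auto simp: sgn_if)
  qed
  ultimately show ?thesis unfolding signed_vecs_def by blast
qed

text \<open>Pairing \<open>b\<close> with its sign pattern gives \<open>A\<close> times the l1 norm
  of \<open>b\<close>, while the pattern has norm \<open>sqrt s * A\<close>. The l1 norm is at least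
  \<open>s * A\<close> on this class, and it dominates the l2 norm; the latter yields the
  correlation bound even when the entries of \<open>b\<close> are large and very unequal.\<close>

lemma Xi_dots:
  assumes b: "b \<in> Xi p s A" and A: "0 < A" and s: "0 < s"
  defines "v \<equiv> \<lambda>j. if b j = 0 then 0 else A * sgn (b j)"
  shows "dot p v v = real s * A\<^sup>2" "dot p v b \<ge> real s * A\<^sup>2" "0 < dot p b b"
    "sqrt (dot p v v) * sqrt (dot p b b) \<le> sqrt (real s) * dot p v b"
proof -
  let ?S = "{i \<in> {..<p}. b i \<noteq> 0}"
  have card: "card ?S = s" using b by (simp add: Xi_def)
  have big: "A \<le> \<bar>b i\<bar>" if "i \<in> ?S" for i using b that by (auto simp: Xi_def)
  have restr: "(\<Sum>i<p. f i) = (\<Sum>i\<in>?S. f i)" if "\<And>i. b i = 0 \<Longrightarrow> f i = 0" for f :: "nat \<Rightarrow> real"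
    using that by (intro sum.mono_neutral_right) auto
  have "dot p v v = (\<Sum>i\<in>?S. v i * v i)" unfolding dot_def by (intro restr) (simp add: v_def)
  also have "\<dots> = (\<Sum>i\<in>?S. A\<^sup>2)" by (intro sum.cong refl) (auto simp: v_def sgn_if power2_eq_square)
  finally show vv: "dot p v v = real s * A\<^sup>2" by (simp only: sum_constant card)
  have vb: "dot p v b = A * (\<Sum>i<p. \<bar>b i\<bar>)"
    unfolding dot_def sum_distrib_left by (intro sum.cong refl) (auto simp: v_def sgn_if abs_if)
  have "(\<Sum>i\<in>?S. A) \<le> (\<Sum>i\<in>?S. \<bar>b i\<bar>)" by (intro sum_mono big)
  also have "\<dots> = (\<Sum>i<p. \<bar>b i\<bar>)" by (rule restr[symmetric]) simp
  finally have "real s * A \<le> (\<Sum>i<p. \<bar>b i\<bar>)" by (simp only: sum_constant card)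
  then have "A * (real s * A) \<le> A * (\<Sum>i<p. \<bar>b i\<bar>)" using A by (intro mult_left_mono) auto
  then show "dot p v b \<ge> real s * A\<^sup>2" unfolding vb by (simp add: power2_eq_square mult_ac)
  have "?S \<noteq> {}" using card s by (metis card.empty less_irrefl)
  then obtain i where i: "i < p" "b i \<noteq> 0" by auto
  then have "0 < b i * b i" by (simp add: zero_less_mult_iff) linarith
  also have "\<dots> \<le> dot p b b" unfolding dot_def using i by (intro member_le_sum) auto
  finally show "0 < dot p b b" .
  have "sqrt (dot p b b) = L2_set b {..<p}" by (simp add: dot_def L2_set_def power2_eq_square)
  also have "\<dots> \<le> (\<Sum>i<p. \<bar>b i\<bar>)" by (rule L2_set_le_sum_abs)
  finally have "sqrt (real s) * A * sqrt (dot p b b) \<le> sqrt (real s) * A * (\<Sum>i<p. \<bar>b i\<bar>)"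
    using A by (intro mult_left_mono) auto
  then show "sqrt (dot p v v) * sqrt (dot p b b) \<le> sqrt (real s) * dot p v b"
    unfolding vv vb using A by (simp add: real_sqrt_mult mult_ac)
qed

text \<open>A signal of least energy \<open>s * A^2\<close> in \<open>Xi\<close>; it serves as the
  single alternative of the lower bound and as witness that \<open>Xi\<close> is nonempty.\<close>

definition flat_signal :: "nat \<Rightarrow> real \<Rightarrow> nat \<Rightarrow> real" where
  "flat_signal s A j = (if j < s then A else 0)"

lemma flat_signal:
  assumes "s \<le> p" "0 < A"
  shows "flat_signal s A \<in> Xi p s A" "dot p (flat_signal s A) (flat_signal s A) = real s * A\<^sup>2"
proof -
  have "{i \<in> {..<p}. flat_signal s A i \<noteq> 0} = {..<s}"
    using assms by (auto simp: flat_signal_def)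
  then show "flat_signal s A \<in> Xi p s A"
    using assms by (auto simp: Xi_def flat_signal_def)
  have "dot p (flat_signal s A) (flat_signal s A) = (\<Sum>i<s. A\<^sup>2)"
    unfolding dot_def using assms
    by (intro sum.mono_neutral_cong_right) (auto simp: flat_signal_def power2_eq_square)
  then show "dot p (flat_signal s A) (flat_signal s A) = real s * A\<^sup>2" by simp
qed

section \<open>Nonasymptotic bounds on the minimax risk\<close>

context concentrated_design
begin

lemma minimax_lower_bound:
  assumes "s \<le> p" "0 < A" "0 < \<eta>"
  shows "1/2 * exp (- (1 + \<eta>) * (real n * (real s * A\<^sup>2)) / 8 - 2 / \<eta>) \<le> minimax_risk n p D s A"
  using minimax_risk_lower[OF flat_signal(1)[OF assms(1,2)] assms(3) second_moment]
    flat_signal(2)[OF assms(1,2)] by simp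

lemma minimax_upper_bound:
  assumes n: "0 < n" and s: "0 < s" "s \<le> p" and A: "0 < A" and \<eta>: "0 < \<eta>" "\<eta> < 1"
  shows "minimax_risk n p D s A
    \<le> (real ((2 * p) ^ s) + 1) * exp (- ((1 - \<eta>)\<^sup>2 / (1 + \<eta>)) * (real n * (real s * A\<^sup>2)) / 8)
      + 2 * exp (- \<kappa> * \<eta>\<^sup>2 / real s)"
proof -
  define M where "M = real n * (real s * A\<^sup>2)"
  have M: "0 < M" using n s A by (simp add: M_def)
  \<comment> \<open>Solves \<open>2 * \<theta> * sqrt ((1 + \<eta>) * M) = (1 - \<eta>) * M\<close>:
    the guaranteed signal \<open>(1 - \<eta>) * M\<close> is compared with the largest possible norm
    of \<open>X v\<close> on the good event.\<close>
  define \<theta> where "\<theta> = (1 - \<eta>) * sqrt M / (2 * sqrt (1 + \<eta>))"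
  have \<theta>: "0 < \<theta>" using M \<eta> by (simp add: \<theta>_def)
  have \<theta>2: "\<theta>\<^sup>2 / 2 = (1 - \<eta>)\<^sup>2 / (1 + \<eta>) * M / 8"
    using M \<eta> by (simp add: \<theta>_def power_divide power_mult_distrib)
  let ?V = "signed_vecs p s A"
  have "minimax_risk n p D s A \<le> (card ?V + 1) * exp (- \<theta>\<^sup>2 / 2) + 2 * exp (- \<kappa> * \<eta>\<^sup>2 / real s)"
  proof (rule minimax_risk_upper[OF finite_signed_vecs \<theta>])
    show "Xi p s A \<noteq> {}" using flat_signal(1)[OF s(2) A] by auto
    fix b assume b: "b \<in> Xi p s A"
    let ?v = "\<lambda>j. if b j = 0 then 0 else A * sgn (b j)"
    note dots = Xi_dots[OF b A s(1)]
    have vv: "0 < dot p ?v ?v" using dots(1) s A by simp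
    have "\<exists>G\<in>sets D. D.prob (space D - G) \<le> 2 * exp (- \<kappa> * \<eta>\<^sup>2 / real s) \<and>
        (\<forall>X\<in>G. (1 - \<eta>) * real n * dot p ?v b < dot n (fit X ?v) (fit X b) \<and>
               dot n (fit X ?v) (fit X ?v) < (1 + \<eta>) * real n * dot p ?v ?v)"
      using s \<eta> by (intro good_event vv dots(3,4)) auto
    then obtain G where G: "G \<in> sets D" "D.prob (space D - G) \<le> 2 * exp (- \<kappa> * \<eta>\<^sup>2 / real s)"
      and sep: "\<And>X. X \<in> G \<Longrightarrow> (1 - \<eta>) * real n * dot p ?v b < dot n (fit X ?v) (fit X b)"
        "\<And>X. X \<in> G \<Longrightarrow> dot n (fit X ?v) (fit X ?v) < (1 + \<eta>) * real n * dot p ?v ?v" by blast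
    have "0 < dot n (fit X ?v) (fit X ?v) \<and>
        2 * \<theta> * sqrt (dot n (fit X ?v) (fit X ?v)) \<le> dot n (fit X ?v) (fit X b)" if X: "X \<in> G" for X
    proof
      have "(1 - \<eta>) * M \<le> (1 - \<eta>) * real n * dot p ?v b"
        using dots(2) \<eta> unfolding M_def mult.assoc by (intro mult_left_mono) auto
      with sep(1)[OF X] have lower: "(1 - \<eta>) * M < dot n (fit X ?v) (fit X b)" by linarith
      have "0 < (1 - \<eta>) * M" using M \<eta> by simp
      \<comment> \<open>A vanishing \<open>X v\<close> would be orthogonal to \<open>X b\<close>, so
        the lower bound on the inner product also shows that the statistic is nondegenerate.\<close>
      with lower have "dot n (fit X ?v) (fit X b) \<noteq> 0" by linarith
      then have "dot n (fit X ?v) (fit X ?v) \<noteq> 0" by (metis dot_eq_zero)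
      then show "0 < dot n (fit X ?v) (fit X ?v)" using dot_self_nonneg[of n "fit X ?v"] by linarith
      have "dot n (fit X ?v) (fit X ?v) \<le> (1 + \<eta>) * M"
        using sep(2)[OF X] dots(1) by (simp add: M_def mult.assoc)
      then have "2 * \<theta> * sqrt (dot n (fit X ?v) (fit X ?v)) \<le> 2 * \<theta> * sqrt ((1 + \<eta>) * M)"
        using \<theta> by (intro mult_left_mono) auto
      also have "\<dots> = (1 - \<eta>) * M"
        using \<eta> M by (simp add: \<theta>_def real_sqrt_mult)
      finally show "2 * \<theta> * sqrt (dot n (fit X ?v) (fit X ?v)) \<le> dot n (fit X ?v) (fit X b)"
        using lower by linarith
    qed
    then show "\<exists>v\<in>?V. \<exists>G\<in>sets D. D.prob (space D - G) \<le> 2 * exp (- \<kappa> * \<eta>\<^sup>2 / real s) \<and>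
      (\<forall>X\<in>G. 0 < dot n (fit X v) (fit X v) \<and>
        2 * \<theta> * sqrt (dot n (fit X v) (fit X v)) \<le> dot n (fit X v) (fit X b))"
      using G by (intro bexI[OF _ sign_pattern_in_signed_vecs[OF b]]) blast
  qed
  also have "exp (- \<theta>\<^sup>2 / 2) = exp (- ((1 - \<eta>)\<^sup>2 / (1 + \<eta>)) * M / 8)"
    by (simp only: minus_mult_left[symmetric] minus_divide_left[symmetric] \<theta>2)
  also have "(card ?V + 1) * exp (- ((1 - \<eta>)\<^sup>2 / (1 + \<eta>)) * M / 8)
      \<le> (real ((2 * p) ^ s) + 1) * exp (- ((1 - \<eta>)\<^sup>2 / (1 + \<eta>)) * M / 8)"
    using card_signed_vecs[of p s A] by (intro mult_right_mono) (simp_all only: of_nat_add of_nat_1 add_right_mono of_nat_mono exp_ge_zero)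
  finally show ?thesis unfolding M_def by simp
qed

end

section \<open>Asymptotics\<close>

lemma round_powr_asymp:
  assumes "0 < e"
  shows "(\<lambda>p::nat. real (nat (round (real p powr e))) / real p powr e) \<longlonglongrightarrow> 1"
proof -
  have inf: "filterlim (\<lambda>p::nat. real p powr e) at_top at_top"
    using assms by real_asymp
  have "(\<lambda>p::nat. inverse (real p powr e)) \<longlonglongrightarrow> 0"
    by (rule tendsto_inverse_0_at_top[OF inf])
  moreover have "eventually (\<lambda>p::nat. norm (real (nat (round (real p powr e))) / real p powr e - 1)
      \<le> inverse (real p powr e)) sequentially"
    using eventually_gt_at_top[of 0]
  proof eventually_elim
    case (elim p)
    let ?x = "real p powr e"
    have x: "0 < ?x" using elim by simp
    have "0 \<le> round ?x" using round_mono[of 0 ?x] by simp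
    then have "\<bar>real (nat (round ?x)) - ?x\<bar> \<le> 1"
      using of_int_round_abs_le[of ?x] by simp
    then show ?case using x by (simp add: field_simps abs_le_iff)
  qed
  ultimately have "(\<lambda>p::nat. real (nat (round (real p powr e))) / real p powr e - 1) \<longlonglongrightarrow> 0"
    by (rule Lim_null_comparison[rotated])
  then show ?thesis by (simp add: LIM_zero_iff)
qed

definition sparsity :: "real \<Rightarrow> nat \<Rightarrow> nat" where
  "sparsity \<alpha> p = nat (round (real p powr (1 - \<alpha>)))"

text \<open>Isolates the effect of rounding in one factor tending to 1, so that everything else is a
  pure power of \<open>p\<close>.\<close>

definition sparsity_ratio :: "real \<Rightarrow> nat \<Rightarrow> real" where
  "sparsity_ratio \<alpha> p = real (sparsity \<alpha> p) / real p powr (1 - \<alpha>)"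

context
  fixes \<alpha> \<delta> :: real
  assumes \<alpha>: "0 < \<alpha>" "\<alpha> \<le> 1/2" and \<delta>: "0 < \<delta>" "\<delta> < 1/2" "\<alpha> - 1/2 + \<delta> > 0"
begin

lemma sparsity_ratio_tendsto: "sparsity_ratio \<alpha> \<longlonglongrightarrow> 1"
  using round_powr_asymp[of "1 - \<alpha>"] \<alpha> by (simp add: sparsity_ratio_def[abs_def] sparsity_def)

lemma sparsity_eq: "0 < p \<Longrightarrow> real (sparsity \<alpha> p) = sparsity_ratio \<alpha> p * real p powr (1 - \<alpha>)"
  by (simp add: sparsity_ratio_def)

lemma eventually_sparsity:
  "eventually (\<lambda>p. 0 < sparsity \<alpha> p \<and> sparsity \<alpha> p \<le> p \<and> sparsity_ratio \<alpha> p \<le> 2) sequentially"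
proof -
  have h: "eventually (\<lambda>p. sparsity_ratio \<alpha> p < 2) sequentially" "eventually (\<lambda>p. 0 < sparsity_ratio \<alpha> p) sequentially"
    using order_tendstoD[OF sparsity_ratio_tendsto] by auto
  have "eventually (\<lambda>p::nat. 2 * real p powr (1 - \<alpha>) \<le> real p) sequentially"
    using \<alpha> by real_asymp
  then show ?thesis using h eventually_gt_at_top[of 0]
  proof eventually_elim
    case (elim p)
    have "real (sparsity \<alpha> p) \<le> 2 * real p powr (1 - \<alpha>)"
      using elim by (subst sparsity_eq) (auto intro!: mult_right_mono)
    then have "sparsity \<alpha> p \<le> p" using elim by linarith
    moreover have "0 < sparsity \<alpha> p" using elim(3) by (auto simp: sparsity_ratio_def zero_less_divide_iff)
    moreover have "sparsity_ratio \<alpha> p \<le> 2" using elim by linarith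
    ultimately show ?case by blast
  qed
qed

text \<open>The \<open>n\<close> in the energy cancels the \<open>1 / n\<close> in the squared
  amplitude, and the exponents \<open>1 - \<alpha>\<close> and
  \<open>\<alpha> - 1/2 + \<delta>\<close> add up to \<open>1/2 + \<delta>\<close>.\<close>

lemma signal_strength:
  assumes "0 < n" "0 < p"
  shows "real n * (real (sparsity \<alpha> p) * (sqrt (real p powr (\<alpha> - 1/2 + \<delta>) / real n))\<^sup>2)
    = sparsity_ratio \<alpha> p * real p powr (1/2 + \<delta>)"
proof -
  have "real n * (real (sparsity \<alpha> p) * (sqrt (real p powr (\<alpha> - 1/2 + \<delta>) / real n))\<^sup>2)
      = sparsity_ratio \<alpha> p * (real p powr (1 - \<alpha>) * real p powr (\<alpha> - 1/2 + \<delta>))"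
    using assms by (simp add: sparsity_eq)
  also have "real p powr (1 - \<alpha>) * real p powr (\<alpha> - 1/2 + \<delta>) = real p powr (1/2 + \<delta>)"
    by (simp add: powr_add[symmetric])
  finally show ?thesis .
qed

lemma lower_rate:
  assumes \<eta>: "0 < \<eta>"
  shows "(\<lambda>p. (- (1 + \<eta>) * (sparsity_ratio \<alpha> p * real p powr (1/2 + \<delta>)) / 8 - 2 / \<eta> - ln 2)
    / real p powr (1/2 + \<delta>)) \<longlonglongrightarrow> - (1 + \<eta>) / 8"
proof -
  have "(\<lambda>p::nat. (2 / \<eta> + ln 2) / real p powr (1/2 + \<delta>)) \<longlonglongrightarrow> 0"
    using \<delta> by real_asymp
  then have "(\<lambda>p. - (1 + \<eta>) * sparsity_ratio \<alpha> p / 8 - (2 / \<eta> + ln 2) / real p powr (1/2 + \<delta>))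
      \<longlonglongrightarrow> - (1 + \<eta>) * 1 / 8 - 0"
    by (intro tendsto_intros sparsity_ratio_tendsto) auto
  moreover have "eventually (\<lambda>p. - (1 + \<eta>) * sparsity_ratio \<alpha> p / 8 - (2 / \<eta> + ln 2) / real p powr (1/2 + \<delta>)
     = (- (1 + \<eta>) * (sparsity_ratio \<alpha> p * real p powr (1/2 + \<delta>)) / 8 - 2 / \<eta> - ln 2)
    / real p powr (1/2 + \<delta>)) sequentially"
    using eventually_gt_at_top[of 0] by eventually_elim (simp add: diff_divide_distrib add_divide_distrib)
  ultimately show ?thesis by (auto elim: Lim_transform_eventually)
qed

text \<open>Relative to \<open>p powr (1/2 + \<delta>)\<close> the entropy of the scan is of order
  \<open>ln p / p powr g\<close> with \<open>g = \<alpha> - 1/2 + \<delta>\<close>, which vanishes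
  because \<open>g\<close> is positive.\<close>

lemma upper_rate:
  "(\<lambda>p. (ln 4 + real (sparsity \<alpha> p) * ln (2 * real p) - c * (sparsity_ratio \<alpha> p * real p powr (1/2 + \<delta>)) / 8)
    / real p powr (1/2 + \<delta>)) \<longlonglongrightarrow> - c / 8"
proof -
  define g where "g = \<alpha> - 1/2 + \<delta>"
  have g: "0 < g" using \<delta> by (simp add: g_def)
  have "(\<lambda>p::nat. ln 4 / real p powr (1/2 + \<delta>)) \<longlonglongrightarrow> 0" using \<delta> by real_asymp
  moreover have "(\<lambda>p::nat. ln (2 * real p) / real p powr g) \<longlonglongrightarrow> 0" using g by real_asymp
  ultimately have "(\<lambda>p. ln 4 / real p powr (1/2 + \<delta>) + sparsity_ratio \<alpha> p * (ln (2 * real p) / real p powr g)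
      - c * sparsity_ratio \<alpha> p / 8) \<longlonglongrightarrow> 0 + 1 * 0 - c * 1 / 8"
    by (intro tendsto_intros sparsity_ratio_tendsto) auto
  moreover have "eventually (\<lambda>p. ln 4 / real p powr (1/2 + \<delta>) + sparsity_ratio \<alpha> p * (ln (2 * real p) / real p powr g)
      - c * sparsity_ratio \<alpha> p / 8 =
    (ln 4 + real (sparsity \<alpha> p) * ln (2 * real p) - c * (sparsity_ratio \<alpha> p * real p powr (1/2 + \<delta>)) / 8)
    / real p powr (1/2 + \<delta>)) sequentially"
    using eventually_gt_at_top[of 0]
  proof eventually_elim
    case (elim p)
    have "real p powr (1 - \<alpha>) / real p powr (1/2 + \<delta>) = 1 / real p powr g"
    proof -
      have "1 - \<alpha> - (1/2 + \<delta>) = - g" by (simp add: g_def)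
      then show ?thesis by (metis powr_diff powr_minus_divide)
    qed
    from arg_cong[OF this, of "\<lambda>x. sparsity_ratio \<alpha> p * x"]
    have "real (sparsity \<alpha> p) / real p powr (1/2 + \<delta>) = sparsity_ratio \<alpha> p / real p powr g"
      using elim by (simp add: sparsity_eq)
    then have "real (sparsity \<alpha> p) * ln (2 * real p) / real p powr (1/2 + \<delta>)
        = sparsity_ratio \<alpha> p * (ln (2 * real p) / real p powr g)"
      by (metis (no_types, lifting) mult.commute times_divide_eq_left times_divide_eq_right)
    then show ?case using elim by (simp add: add_divide_distrib diff_divide_distrib)
  qed
  ultimately show ?thesis by (auto elim: Lim_transform_eventually)
qed

text \<open>Ensures that the bad design event is no more likely, on the exponential scale, than the
  Gaussian errors. After clearing the denominator this compares
  \<open>s * p powr (1/2 + \<delta>)\<close> with \<open>p^2\<close>.\<close>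

lemma concentration_dominates:
  assumes "0 < \<eta>" and \<kappa>: "eventually (\<lambda>p. (real p)\<^sup>2 \<le> \<kappa> p) sequentially"
  shows "eventually (\<lambda>p. sparsity_ratio \<alpha> p * real p powr (1/2 + \<delta>) / 8 \<le> \<kappa> p * \<eta>\<^sup>2 / real (sparsity \<alpha> p)) sequentially"
proof -
  have "eventually (\<lambda>p::nat. real p powr (1/2 + \<delta>) * real p powr (1 - \<alpha>) / 2 \<le> (real p)\<^sup>2 * \<eta>\<^sup>2) sequentially"
  proof -
    \<comment> \<open>The product of the two powers is \<open>p powr (2 - e)\<close>;
      \<open>e\<close> is positive because \<open>\<delta> < 1/2\<close> and
      \<open>\<alpha> > 0\<close>.\<close>
    define e where "e = 1/2 + \<alpha> - \<delta>"
    have "0 < e" using \<alpha> \<delta> by (simp add: e_def)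
    then have "(\<lambda>p::nat. real p powr (- e)) \<longlonglongrightarrow> 0" by real_asymp
    then have "eventually (\<lambda>p::nat. real p powr (- e) < \<eta>\<^sup>2) sequentially"
      using assms by (intro order_tendstoD) auto
    then show ?thesis using eventually_gt_at_top[of 0]
    proof eventually_elim
      case (elim p)
      have "real p powr (1/2 + \<delta>) * real p powr (1 - \<alpha>) = (real p)\<^sup>2 * real p powr (- e)"
        using elim by (simp add: powr_add[symmetric] powr_realpow[symmetric] e_def algebra_simps del: powr_numeral)
      also have "\<dots> \<le> (real p)\<^sup>2 * \<eta>\<^sup>2" using elim by (intro mult_left_mono) auto
      finally show ?case by (simp add: divide_le_eq) (smt (verit) zero_le_mult_iff zero_le_power2)
    qed
  qed
  then show ?thesis using \<kappa> eventually_sparsity eventually_gt_at_top[of 0]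
  proof eventually_elim
    case (elim p)
    let ?R = "real p powr (1/2 + \<delta>)" and ?Q = "real p powr (1 - \<alpha>)"
    have h0: "0 \<le> sparsity_ratio \<alpha> p" by (simp add: sparsity_ratio_def)
    have "sparsity_ratio \<alpha> p * ?R / 8 * real (sparsity \<alpha> p) = (sparsity_ratio \<alpha> p * sparsity_ratio \<alpha> p) * (?R * ?Q) / 8"
      using elim by (simp add: sparsity_eq)
    also have "\<dots> \<le> (2 * 2) * (?R * ?Q) / 8"
      using elim h0 by (intro divide_right_mono mult_right_mono mult_mono) auto
    also have "\<dots> = ?R * ?Q / 2" by simp
    also have "\<dots> \<le> (real p)\<^sup>2 * \<eta>\<^sup>2" using elim by simp
    also have "\<dots> \<le> \<kappa> p * \<eta>\<^sup>2" using elim by (intro mult_right_mono) auto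
    finally show ?case using elim by (simp add: pos_le_divide_eq)
  qed
qed

text \<open>For fixed \<open>\<eta>\<close> the two nonasymptotic bounds enclose the ratio between
  sequences with limits \<open>- (1 + \<eta>) / 8\<close> and
  \<open>- ((1 - \<eta>)\<^sup>2 / (1 + \<eta>)) / 8\<close>; both approach \<open>- 1/8\<close> as
  \<open>\<eta>\<close> tends to 0.\<close>

theorem concentrated_minimax_rate:
  fixes n :: "nat \<Rightarrow> nat" and \<kappa> :: "nat \<Rightarrow> real"
  assumes design: "eventually (\<lambda>p. concentrated_design (n p) p (D p) (\<kappa> p)) sequentially"
    and n: "eventually (\<lambda>p. 0 < n p) sequentially"
    and \<kappa>: "eventually (\<lambda>p. (real p)\<^sup>2 \<le> \<kappa> p) sequentially"
  shows "(\<lambda>p. ln (minimax_risk (n p) p (D p) (sparsity \<alpha> p) (sqrt (real p powr (\<alpha> - 1/2 + \<delta>) / real (n p))))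
      / real p powr (1/2 + \<delta>)) \<longlonglongrightarrow> - 1/8"
    (is "?f \<longlonglongrightarrow> _")
proof -
  let ?A = "\<lambda>p. sqrt (real p powr (\<alpha> - 1/2 + \<delta>) / real (n p))"
  let ?M = "\<lambda>p. sparsity_ratio \<alpha> p * real p powr (1/2 + \<delta>)"
  let ?R = "\<lambda>p. minimax_risk (n p) p (D p) (sparsity \<alpha> p) (?A p)"
  have lower: "eventually (\<lambda>p. 0 < ?R p \<and> (- (1 + \<eta>) * ?M p / 8 - 2 / \<eta> - ln 2) / real p powr (1/2 + \<delta>) \<le> ?f p) sequentially"
    if \<eta>: "0 < \<eta>" for \<eta>
    using design n eventually_sparsity eventually_gt_at_top[of 0]
  proof eventually_elim
    case (elim p)
    interpret concentrated_design "n p" p "D p" "\<kappa> p" by (fact elim)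
    have "0 < ?A p" using elim by simp
    from minimax_lower_bound[OF _ this \<eta>, of "sparsity \<alpha> p"] elim
    have L: "1/2 * exp (- (1 + \<eta>) * ?M p / 8 - 2 / \<eta>) \<le> ?R p"
      by (simp only: signal_strength)
    have pos: "0 < 1/2 * exp (- (1 + \<eta>) * ?M p / 8 - 2 / \<eta>)" by simp
    then have R: "0 < ?R p" using L by linarith
    have "ln (1/2 * exp (- (1 + \<eta>) * ?M p / 8 - 2 / \<eta>)) \<le> ln (?R p)"
      using L pos R by (subst ln_le_cancel_iff) auto
    moreover have "ln (1/2 * exp (- (1 + \<eta>) * ?M p / 8 - 2 / \<eta>)) = - (1 + \<eta>) * ?M p / 8 - 2 / \<eta> - ln 2"
      by (subst ln_mult) (auto simp: ln_div)
    ultimately have "- (1 + \<eta>) * ?M p / 8 - 2 / \<eta> - ln 2 \<le> ln (?R p)" by linarith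
    then show ?case using R by (intro conjI divide_right_mono) auto
  qed
  have upper: "eventually (\<lambda>p. ?f p \<le> (ln 4 + real (sparsity \<alpha> p) * ln (2 * real p) - c * ?M p / 8)
      / real p powr (1/2 + \<delta>)) sequentially"
    if \<eta>: "0 < \<eta>" "\<eta> < 1" and c: "c = (1 - \<eta>)\<^sup>2 / (1 + \<eta>)" for \<eta> c
    using design n eventually_sparsity eventually_gt_at_top[of 0] concentration_dominates[OF \<eta>(1) \<kappa>]
      \<comment> \<open>Used here only for the positivity of the risk, which the monotonicity of
        \<open>ln\<close> requires; the value 1 for the slack is arbitrary.\<close>
      lower[of 1, OF zero_less_one]
  proof eventually_elim
    case (elim p)
    interpret concentrated_design "n p" p "D p" "\<kappa> p" by (fact elim)
    have A: "0 < ?A p" using elim by simp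
    define N where "N = real ((2 * p) ^ sparsity \<alpha> p)"
    have "1 \<le> (2 * p) ^ sparsity \<alpha> p" using elim by (intro one_le_power) simp
    then have N: "1 \<le> N" unfolding N_def by (metis of_nat_1 of_nat_mono)
    have c01: "0 \<le> c" "c \<le> 1"
    proof -
      show "0 \<le> c" using \<eta> by (simp add: c)
      have "(1 - \<eta>)\<^sup>2 \<le> 1" using \<eta> by (intro power_le_one) auto
      then show "c \<le> 1" using \<eta> by (simp add: c divide_le_eq)
    qed
    have M0: "0 \<le> ?M p" by (simp add: sparsity_ratio_def)
    have cM: "c * ?M p / 8 \<le> ?M p / 8" using mult_right_mono[OF c01(2) M0] by simp
    from minimax_upper_bound[OF _ _ _ A \<eta>, of "sparsity \<alpha> p"] elim
    have "?R p \<le> (N + 1) * exp (- c * ?M p / 8) + 2 * exp (- \<kappa> p * \<eta>\<^sup>2 / real (sparsity \<alpha> p))"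
      by (simp only: signal_strength c N_def)
    also have "\<dots> \<le> (N + 1) * exp (- c * ?M p / 8) + 2 * exp (- c * ?M p / 8)"
    proof -
      have "- \<kappa> p * \<eta>\<^sup>2 / real (sparsity \<alpha> p) = - (\<kappa> p * \<eta>\<^sup>2 / real (sparsity \<alpha> p))" by simp
      also have "\<dots> \<le> - (c * ?M p / 8)" using elim cM by linarith
      finally show ?thesis by simp
    qed
    also have "\<dots> = (N + 3) * exp (- c * ?M p / 8)" by (simp add: algebra_simps)
    \<comment> \<open>Since \<open>N\<close> is at least 1, the sum \<open>N + 3\<close> is absorbed
      into a product, whose logarithm splits.\<close>
    also have "\<dots> \<le> (4 * N) * exp (- c * ?M p / 8)"
      using N by (intro mult_right_mono) auto
    finally have U: "?R p \<le> (4 * N) * exp (- c * ?M p / 8)" .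
    have "0 < 4 * N" using N by linarith
    then have "0 < (4 * N) * exp (- c * ?M p / 8)" by (intro mult_pos_pos) auto
    then have "ln (?R p) \<le> ln ((4 * N) * exp (- c * ?M p / 8))"
      using U elim by (intro iffD2[OF ln_le_cancel_iff]) blast+
    also have "\<dots> = ln (4 * N) + (- c * ?M p / 8)"
      using \<open>0 < 4 * N\<close> by (subst ln_mult_pos) (simp_all only: exp_gt_zero ln_exp)
    also have "ln (4 * N) = ln 4 + real (sparsity \<alpha> p) * ln (2 * real p)"
    proof -
      have "N = (2 * real p) ^ sparsity \<alpha> p"
        by (simp only: N_def of_nat_power of_nat_mult of_nat_numeral)
      then have lnN: "ln N = real (sparsity \<alpha> p) * ln (2 * real p)"
        using elim by (simp only: ln_realpow)
      have "ln (4 * N) = ln 4 + ln N" using N by (intro ln_mult_pos) auto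
      then show ?thesis by (simp only: lnN)
    qed
    finally show ?case by (intro divide_right_mono) auto
  qed
  show ?thesis
  proof (rule order_tendstoI)
    fix a :: real assume a: "a < - 1/8"
    \<comment> \<open>Then \<open>- (1 + \<eta>) / 8 = - 1/8 - \<eta> / 8\<close>, which exceeds
      \<open>- 1/8 - \<eta> = a\<close>.\<close>
    define \<eta> where "\<eta> = (- 1/8 - a)"
    have \<eta>: "0 < \<eta>" "a < - (1 + \<eta>) / 8" using a by (auto simp: \<eta>_def)
    show "eventually (\<lambda>p. a < ?f p) sequentially"
      using order_tendstoD(1)[OF lower_rate[OF \<eta>(1)] \<eta>(2)] lower[OF \<eta>(1)]
      by eventually_elim auto
  next
    fix a :: real assume a: "- 1/8 < a"
    have "((\<lambda>\<eta>::real. - ((1 - \<eta>)\<^sup>2 / (1 + \<eta>)) / 8) \<longlongrightarrow> - ((1 - 0)\<^sup>2 / (1 + 0)) / 8) (at_right 0)"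
      by (intro tendsto_intros) auto
    then have "eventually (\<lambda>\<eta>::real. - ((1 - \<eta>)\<^sup>2 / (1 + \<eta>)) / 8 < a) (at_right 0)"
      using a by (intro order_tendstoD(2)) auto
    moreover have "eventually (\<lambda>\<eta>::real. \<eta> \<in> {0<..<1}) (at_right 0)"
      by (rule eventually_at_right_real) simp
    ultimately have "eventually (\<lambda>\<eta>::real. - ((1 - \<eta>)\<^sup>2 / (1 + \<eta>)) / 8 < a \<and> \<eta> \<in> {0<..<1}) (at_right 0)"
      by (rule eventually_conj)
    then obtain \<eta> :: real where \<eta>: "0 < \<eta>" "\<eta> < 1" "- ((1 - \<eta>)\<^sup>2 / (1 + \<eta>)) / 8 < a"
      using eventually_happens[of _ "at_right (0::real)"] by auto
    show "eventually (\<lambda>p. ?f p < a) sequentially"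
      using order_tendstoD(2)[OF upper_rate \<eta>(3)] upper[OF \<eta>(1,2) refl]
      by eventually_elim auto
  qed
qed

end

theorem mainTheorem4:
  fixes \<alpha> \<delta> \<sigma>2 :: real and n :: "nat \<Rightarrow> nat"
    and D :: "nat \<Rightarrow> (nat \<Rightarrow> nat \<Rightarrow> real) measure"
  assumes "0 < \<alpha>" "\<alpha> \<le> 1/2" "0 < \<delta>" "\<delta> < 1/2" "\<alpha> - 1/2 + \<delta> > 0"
    and "filterlim n at_top at_top"
    and "((\<forall>p. subG_design (n p) p \<sigma>2 (D p))
            \<and> filterlim (\<lambda>p. real (n p) / (real p)\<^sup>2) at_top at_top)
         \<or> ((\<forall>p. orth_design (n p) p (D p)) \<and> (\<forall>p. p \<le> n p))"
  shows "(\<lambda>p. ln (minimax_risk (n p) p (D p) (nat (round (real p powr (1 - \<alpha>))))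
                 (sqrt (real p powr (\<alpha> - 1/2 + \<delta>) / real (n p))))
              / real p powr (1/2 + \<delta>)) \<longlonglongrightarrow> - 1/8"
proof -
  have n: "eventually (\<lambda>p. 0 < n p) sequentially"
    using eventually_compose_filterlim[OF eventually_gt_at_top assms(6)] .
  obtain \<kappa> :: "nat \<Rightarrow> real" where "eventually (\<lambda>p. concentrated_design (n p) p (D p) (\<kappa> p)) sequentially"
    and "eventually (\<lambda>p. (real p)\<^sup>2 \<le> \<kappa> p) sequentially"
    using assms(7)
  proof (elim disjE conjE)
    assume subG: "\<forall>p. subG_design (n p) p \<sigma>2 (D p)"
      and ratio: "filterlim (\<lambda>p. real (n p) / (real p)\<^sup>2) at_top at_top"
    define S where "S = max 1 \<sigma>2"
    have S: "1 \<le> S" "\<sigma>2 \<le> S" by (auto simp: S_def)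
    let ?\<kappa> = "\<lambda>p. real (n p) / (4096 * S\<^sup>2)"
    \<comment> \<open>As \<open>n / p^2\<close> diverges, it eventually passes the constant of the
      concentration rate, whatever the size of \<open>S\<close>.\<close>
    have "eventually (\<lambda>p. 4096 * S\<^sup>2 \<le> real (n p) / (real p)\<^sup>2) sequentially"
      using ratio by (simp add: filterlim_at_top)
    then have "eventually (\<lambda>p. (real p)\<^sup>2 \<le> ?\<kappa> p) sequentially"
      using eventually_gt_at_top[of 0]
    proof eventually_elim
      case (elim p)
      have "0 < 4096 * S\<^sup>2" using S by simp
      with elim show ?case by (simp add: pos_le_divide_eq mult.commute)
    qed
    moreover have "eventually (\<lambda>p. concentrated_design (n p) p (D p) (?\<kappa> p)) sequentially"
      using subG S by (intro always_eventually allI concentrated_design_subG[where ?\<sigma>2.0=\<sigma>2]) auto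
    ultimately show thesis by (rule that[rotated])
  next
    assume orth: "\<forall>p. orth_design (n p) p (D p)"
    \<comment> \<open>For an orthogonal design any rate is available, so the required
      \<open>p^2\<close> is simply chosen.\<close>
    have "eventually (\<lambda>p. concentrated_design (n p) p (D p) ((real p)\<^sup>2)) sequentially"
      using n by eventually_elim (use orth in \<open>auto intro: concentrated_design_orth\<close>)
    then show thesis using that by auto
  qed
  from concentrated_minimax_rate[OF assms(1-5) this(1) n this(2)]
  show ?thesis by (simp add: sparsity_def)
qed

end
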